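(* Let $M$ be a pseudo-umbilical submanifold of a locally product Riemannian manifold $(\overline{M},g)$ with product structure $F$, and let $H$ be the mean curvature vector field of $M$. Then the identity $$g\big((\nabla_X\omega)Y,H\big)=g\big(Y,A_{CH}X\big)$$ is satisfied for all $X,Y\in\Gamma(TM)$ if and only if one of the following is satisfied: (1) $M$ is a minimal submanifold; (2) $M$ is an anti-invariant submanifold. Here $(\nabla_X\omega)Y=\nabla_X^{\bot}\omega Y-\omega\nabla_XY$.
   Context: Locally product Riemannian manifold: a Riemannian manifold $(\overline{M},g)$ with Levi-Civita connection $\overline{\nabla}$, equipped with a $(1,1)$-tensor field $F$ (the product structure) such that $F^2=I$, $F\neq\pm I$, $g(FX,FY)=g(X,Y)$ and $(\overline{\nabla}_XF)Y=0$ for all $X,Y\in\Gamma(T\overline{M})$. Let $M$ be an isometrically immersed Riemannian submanifold of $\overline{M}$, with tangent bundle $TM$, normal bundle $TM^{\bot}$ and Levi-Civita connection $\nabla$. For $X,Y\in\Gamma(TM)$ and $\xi\in\Gamma(TM^{\bot})$, the Gauss and Weingarten formulas $\overline{\nabla}_XY=\nabla_XY+h(X,Y)$ and $\overline{\nabla}_X\xi=-A_\xi X+\nabla_X^{\bot}\xi$ (decompositions into tangent and normal parts) define the second fundamental form $h$, the shape operator $A_\xi$ and the normal connection $\nabla^{\bot}$; one has $g(A_\xi X,Y)=g(h(X,Y),\xi)$. The mean curvature vector field is $H=\frac1n\sum_{i=1}^n h(e_i,e_i)$, where $n=\dim M$ and $\{e_i\}$ is a local orthonormal frame of $TM$. $M$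 is minimal if $H=0$. $M$ is pseudo-umbilical if $g(h(X,Y),H)=g(X,Y)g(H,H)$ for all $X,Y\in\Gamma(TM)$. For $X\in\Gamma(TM)$ write $FX=\phi X+\omega X$ with $\phi X$ tangent and $\omega X$ normal to $M$. For $\xi\in\Gamma(TM^{\bot})$ write $F\xi=B\xi+C\xi$ with $B\xi$ tangent and $C\xi$ normal to $M$. $M$ is a semi-invariant submanifold if there are two distributions $D,D^{\bot}$ on $M$ with $TM=D\oplus D^{\bot}$, $F(D)=D$ and $F(D^{\bot})\subset TM^{\bot}$. It is an anti-invariant submanifold if moreover $\dim D=0$; equivalently, $\phi$ is identically zero.
   Formalization: As stated the claim fails: H and φ may vanish on different parts of M. The equivalence with (1) or (2) is proved for semi-invariant M; for every pseudo-umbilical M the identity is shown equivalent to "at each point H = 0 or φ = 0". *)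

theory Defs
  imports "HOL-Analysis.Analysis"
begin

section \<open>Smooth functions between Euclidean spaces\<close>

text \<open>Used for open \<open>S\<close> only.\<close>

primrec Ck_on :: "nat \<Rightarrow> 'a::euclidean_space set \<Rightarrow> ('a \<Rightarrow> 'c::real_normed_vector) \<Rightarrow> bool" where
  "Ck_on 0 S f \<longleftrightarrow> continuous_on S f"
| "Ck_on (Suc k) S f \<longleftrightarrow> (\<forall>x\<in>S. f differentiable (at x)) \<and>
     (\<forall>v. Ck_on k S (\<lambda>x. frechet_derivative f (at x) v))"

definition smooth_on :: "'a::euclidean_space set \<Rightarrow> ('a \<Rightarrow> 'c::real_normed_vector) \<Rightarrow> bool" where
  "smooth_on S f \<longleftrightarrow> (\<forall>k. Ck_on k S f)"


section \<open>Smooth manifolds\<close>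

text \<open>
  A manifold is a Hausdorff second countable type \<open>'m\<close> with a smooth atlas modelled on a Euclidean
  space \<open>'a\<close>.  The atlas is given as a family of charts indexed by the points, \<open>coord M p\<close> being a
  chart on a neighbourhood \<open>cdom M p\<close> of \<open>p\<close>; every smooth structure is given by such an atlas.
  The tangent space at \<open>p\<close> is identified with \<open>'a\<close> by means of the chart \<open>coord M p\<close>.
  So a tangent vector at \<open>p\<close> is an element of \<open>'a\<close>, to be converted by \<open>tchange\<close> whenever
  its components in another chart are needed.
\<close>

record ('m, 'a) atlas =
  cdom :: "'m \<Rightarrow> 'm set"
  coord :: "'m \<Rightarrow> 'm \<Rightarrow> 'a"

definition cinv :: "('m, 'a, 'z) atlas_scheme \<Rightarrow> 'm \<Rightarrow> 'a \<Rightarrow> 'm" where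
  "cinv M p = inv_into (cdom M p) (coord M p)"

definition smooth_manifold ::
  "('m::{t2_space,second_countable_topology}, 'a::euclidean_space, 'z) atlas_scheme \<Rightarrow> bool" where
  "smooth_manifold M \<longleftrightarrow>
     (\<forall>p. p \<in> cdom M p \<and> open (cdom M p) \<and> open (coord M p ` cdom M p) \<and>
          homeomorphism (cdom M p) (coord M p ` cdom M p) (coord M p) (cinv M p)) \<and>
     (\<forall>p q. smooth_on (coord M p ` (cdom M p \<inter> cdom M q)) (\<lambda>x. coord M q (cinv M p x)))"

definition smooth_fun ::
  "('m, 'a::euclidean_space, 'z) atlas_scheme \<Rightarrow> ('m \<Rightarrow> real) \<Rightarrow> bool" where
  "smooth_fun M h \<longleftrightarrow> (\<forall>p. smooth_on (coord M p ` cdom M p) (\<lambda>x. h (cinv M p x)))"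

definition smooth_map ::
  "('m::topological_space, 'a::euclidean_space, 'y) atlas_scheme \<Rightarrow>
   ('n::topological_space, 'b::euclidean_space, 'z) atlas_scheme \<Rightarrow> ('m \<Rightarrow> 'n) \<Rightarrow> bool" where
  "smooth_map M N f \<longleftrightarrow> continuous_on UNIV f \<and>
     (\<forall>p q. smooth_on (coord M p ` (cdom M p \<inter> f -` cdom N q)) (\<lambda>x. coord N q (f (cinv M p x))))"

text \<open>Change of components of a tangent vector at \<open>r\<close> from the chart \<open>coord M p\<close> to the chart
  \<open>coord M q\<close>.\<close>

definition tchange ::
  "('m, 'a::euclidean_space, 'z) atlas_scheme \<Rightarrow> 'm \<Rightarrow> 'm \<Rightarrow> 'm \<Rightarrow> 'a \<Rightarrow> 'a" where
  "tchange M p q r = frechet_derivative (\<lambda>x. coord M q (cinv M p x)) (at (coord M p r))"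

definition dderiv ::
  "('m, 'a::euclidean_space, 'z) atlas_scheme \<Rightarrow> ('m \<Rightarrow> real) \<Rightarrow> 'm \<Rightarrow> 'a \<Rightarrow> real" where
  "dderiv M h p u = frechet_derivative (\<lambda>x. h (cinv M p x)) (at (coord M p p)) u"

definition tmap ::
  "('m, 'a::euclidean_space, 'y) atlas_scheme \<Rightarrow> ('n, 'b::euclidean_space, 'z) atlas_scheme \<Rightarrow>
   ('m \<Rightarrow> 'n) \<Rightarrow> 'm \<Rightarrow> 'a \<Rightarrow> 'b" where
  "tmap M N f p = frechet_derivative (\<lambda>x. coord N (f p) (f (cinv M p x))) (at (coord M p p))"

text \<open>Smooth vector fields along \<open>f : M \<rightarrow> N\<close>, that is, sections of the pullback of the tangent
  bundle of \<open>N\<close>: \<open>V p\<close> is a tangent vector of \<open>N\<close> at \<open>f p\<close>.\<close>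

definition field_along ::
  "('m, 'a::euclidean_space, 'y) atlas_scheme \<Rightarrow> ('n, 'b::euclidean_space, 'z) atlas_scheme \<Rightarrow>
   ('m \<Rightarrow> 'n) \<Rightarrow> ('m \<Rightarrow> 'b) \<Rightarrow> bool" where
  "field_along M N f V \<longleftrightarrow>
     (\<forall>p q. smooth_on (coord M p ` (cdom M p \<inter> f -` cdom N q))
        (\<lambda>x. let r = cinv M p x in tchange N (f r) q (f r) (V r)))"

definition vector_field ::
  "('m, 'a::euclidean_space, 'z) atlas_scheme \<Rightarrow> ('m \<Rightarrow> 'a) \<Rightarrow> bool" where
  "vector_field M X \<longleftrightarrow> field_along M M (\<lambda>p. p) X"

text \<open>Connections on the pullback of the tangent bundle of \<open>N\<close> under \<open>f : M \<rightarrow> N\<close>.\<close>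

definition connection_along ::
  "('m, 'a::euclidean_space, 'y) atlas_scheme \<Rightarrow> ('n, 'b::euclidean_space, 'z) atlas_scheme \<Rightarrow>
   ('m \<Rightarrow> 'n) \<Rightarrow> (('m \<Rightarrow> 'a) \<Rightarrow> ('m \<Rightarrow> 'b) \<Rightarrow> 'm \<Rightarrow> 'b) \<Rightarrow> bool" where
  "connection_along M N f D \<longleftrightarrow>
     (\<forall>X V. vector_field M X \<longrightarrow> field_along M N f V \<longrightarrow> field_along M N f (D X V)) \<and>
     (\<forall>X Y V p. vector_field M X \<longrightarrow> vector_field M Y \<longrightarrow> field_along M N f V \<longrightarrow>
        D (\<lambda>q. X q + Y q) V p = D X V p + D Y V p) \<and>
     (\<forall>h X V p. smooth_fun M h \<longrightarrow> vector_field M X \<longrightarrow> field_along M N f V \<longrightarrow>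
        D (\<lambda>q. h q *\<^sub>R X q) V p = h p *\<^sub>R D X V p) \<and>
     (\<forall>X V W p. vector_field M X \<longrightarrow> field_along M N f V \<longrightarrow> field_along M N f W \<longrightarrow>
        D X (\<lambda>q. V q + W q) p = D X V p + D X W p) \<and>
     (\<forall>h X V p. smooth_fun M h \<longrightarrow> vector_field M X \<longrightarrow> field_along M N f V \<longrightarrow>
        D X (\<lambda>q. h q *\<^sub>R V q) p = dderiv M h p (X p) *\<^sub>R V p + h p *\<^sub>R D X V p)"


section \<open>Riemannian manifolds and locally product structures\<close>

record ('m, 'a) riemannian = "('m, 'a) atlas" +
  metric :: "'m \<Rightarrow> 'a \<Rightarrow> 'a \<Rightarrow> real"
  conn :: "('m \<Rightarrow> 'a) \<Rightarrow> ('m \<Rightarrow> 'a) \<Rightarrow> 'm \<Rightarrow> 'a"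

definition riemannian_metric ::
  "('m, 'a::euclidean_space, 'z) atlas_scheme \<Rightarrow> ('m \<Rightarrow> 'a \<Rightarrow> 'a \<Rightarrow> real) \<Rightarrow> bool" where
  "riemannian_metric M g \<longleftrightarrow>
     (\<forall>p. bilinear (g p) \<and> (\<forall>u v. g p u v = g p v u) \<and> (\<forall>u. u \<noteq> 0 \<longrightarrow> g p u u > 0)) \<and>
     (\<forall>X Y. vector_field M X \<longrightarrow> vector_field M Y \<longrightarrow> smooth_fun M (\<lambda>p. g p (X p) (Y p)))"

text \<open>Torsion-freeness is \<open>\<nabla>\<^sub>X Y - \<nabla>\<^sub>Y X = [X, Y]\<close>, both sides being applied to functions \<open>h\<close>.\<close>

definition levi_civita ::
  "('m, 'a::euclidean_space, 'z) atlas_scheme \<Rightarrow> ('m \<Rightarrow> 'a \<Rightarrow> 'a \<Rightarrow> real) \<Rightarrow>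
   (('m \<Rightarrow> 'a) \<Rightarrow> ('m \<Rightarrow> 'a) \<Rightarrow> 'm \<Rightarrow> 'a) \<Rightarrow> bool" where
  "levi_civita M g nabla \<longleftrightarrow>
     connection_along M M (\<lambda>p. p) nabla \<and>
     (\<forall>X Y h p. vector_field M X \<longrightarrow> vector_field M Y \<longrightarrow> smooth_fun M h \<longrightarrow>
        dderiv M h p (nabla X Y p - nabla Y X p) =
          dderiv M (\<lambda>q. dderiv M h q (Y q)) p (X p) - dderiv M (\<lambda>q. dderiv M h q (X q)) p (Y p)) \<and>
     (\<forall>X Y Z p. vector_field M X \<longrightarrow> vector_field M Y \<longrightarrow> vector_field M Z \<longrightarrow>
        dderiv M (\<lambda>q. g q (Y q) (Z q)) p (X p) =
          g p (nabla X Y p) (Z p) + g p (Y p) (nabla X Z p))"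

definition riemannian_manifold ::
  "('m::{t2_space,second_countable_topology}, 'a::euclidean_space, 'z) riemannian_scheme \<Rightarrow> bool" where
  "riemannian_manifold M \<longleftrightarrow>
     smooth_manifold M \<and> riemannian_metric M (metric M) \<and> levi_civita M (metric M) (conn M)"

record ('m, 'a) product_riemannian = "('m, 'a) riemannian" +
  prodstr :: "'m \<Rightarrow> 'a \<Rightarrow> 'a"

definition locally_product_manifold ::
  "('n::{t2_space,second_countable_topology}, 'b::euclidean_space) product_riemannian \<Rightarrow> bool" where
  "locally_product_manifold N \<longleftrightarrow>
     riemannian_manifold N \<and>
     (\<forall>p. linear (prodstr N p)) \<and>
     (\<forall>X. vector_field N X \<longrightarrow> vector_field N (\<lambda>p. prodstr N p (X p))) \<and>
     (\<forall>p u. prodstr N p (prodstr N p u) = u) \<and>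
     prodstr N \<noteq> (\<lambda>p u. u) \<and> prodstr N \<noteq> (\<lambda>p u. - u) \<and>
     (\<forall>p u v. metric N p (prodstr N p u) (prodstr N p v) = metric N p u v) \<and>
     (\<forall>X Y p. vector_field N X \<longrightarrow> vector_field N Y \<longrightarrow>
        conn N X (\<lambda>q. prodstr N q (Y q)) p - prodstr N p (conn N X Y p) = 0)"


section \<open>Submanifolds\<close>

text \<open>\<open>f\<close> is an immersion because the metric of \<open>M\<close> is positive definite.\<close>

definition isometric_immersion ::
  "('m::topological_space, 'a::euclidean_space, 'y) riemannian_scheme \<Rightarrow>
   ('n::topological_space, 'b::euclidean_space, 'z) riemannian_scheme \<Rightarrow> ('m \<Rightarrow> 'n) \<Rightarrow> bool" where
  "isometric_immersion M N f \<longleftrightarrow> smooth_map M N f \<and>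
     (\<forall>p u v. metric N (f p) (tmap M N f p u) (tmap M N f p v) = metric M p u v)"

text \<open>
  The connection of \<open>N\<close> differentiates fields along \<open>f\<close>, such as images of tangent fields of \<open>M\<close> or
  normal fields, by means of the connection it induces on the pullback bundle.  That connection is
  the only one with \<open>D\<^sub>X (W \<circ> f) = \<nabla>\<^sub>Z W \<circ> f\<close> at the points where \<open>Z \<circ> f\<close> agrees with the image
  of \<open>X\<close>, for vector fields \<open>W\<close>, \<open>Z\<close> of \<open>N\<close>.
\<close>

definition pullback_connection ::
  "('m, 'a::euclidean_space, 'y) riemannian_scheme \<Rightarrow> ('n, 'b::euclidean_space, 'z) riemannian_scheme \<Rightarrow>
   ('m \<Rightarrow> 'n) \<Rightarrow> (('m \<Rightarrow> 'a) \<Rightarrow> ('m \<Rightarrow> 'b) \<Rightarrow> 'm \<Rightarrow> 'b) \<Rightarrow> bool" where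
  "pullback_connection M N f D \<longleftrightarrow>
     connection_along M N f D \<and>
     (\<forall>X Z W p. vector_field M X \<longrightarrow> vector_field N Z \<longrightarrow> vector_field N W \<longrightarrow>
        Z (f p) = tmap M N f p (X p) \<longrightarrow> D X (\<lambda>q. W (f q)) p = conn N Z W (f p))"

text \<open>Below, \<open>D\<close> is always the pullback connection.  Tangent parts are tangent vectors of \<open>M\<close>,
  normal parts are tangent vectors of \<open>N\<close>.\<close>

definition tangent_part ::
  "('m, 'a::euclidean_space, 'y) riemannian_scheme \<Rightarrow> ('n, 'b::euclidean_space, 'z) riemannian_scheme \<Rightarrow>
   ('m \<Rightarrow> 'n) \<Rightarrow> 'm \<Rightarrow> 'b \<Rightarrow> 'a" where
  "tangent_part M N f p w =
     (THE u. \<forall>v. metric N (f p) (w - tmap M N f p u) (tmap M N f p v) = 0)"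

definition normal_part ::
  "('m, 'a::euclidean_space, 'y) riemannian_scheme \<Rightarrow> ('n, 'b::euclidean_space, 'z) riemannian_scheme \<Rightarrow>
   ('m \<Rightarrow> 'n) \<Rightarrow> 'm \<Rightarrow> 'b \<Rightarrow> 'b" where
  "normal_part M N f p w = w - tmap M N f p (tangent_part M N f p w)"

definition second_form ::
  "('m, 'a::euclidean_space, 'y) riemannian_scheme \<Rightarrow> ('n, 'b::euclidean_space, 'z) riemannian_scheme \<Rightarrow>
   ('m \<Rightarrow> 'n) \<Rightarrow> (('m \<Rightarrow> 'a) \<Rightarrow> ('m \<Rightarrow> 'b) \<Rightarrow> 'm \<Rightarrow> 'b) \<Rightarrow> ('m \<Rightarrow> 'a) \<Rightarrow> ('m \<Rightarrow> 'a) \<Rightarrow> 'm \<Rightarrow> 'b" where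
  "second_form M N f D X Y p = normal_part M N f p (D X (\<lambda>q. tmap M N f q (Y q)) p)"

definition shape_operator ::
  "('m, 'a::euclidean_space, 'y) riemannian_scheme \<Rightarrow> ('n, 'b::euclidean_space, 'z) riemannian_scheme \<Rightarrow>
   ('m \<Rightarrow> 'n) \<Rightarrow> (('m \<Rightarrow> 'a) \<Rightarrow> ('m \<Rightarrow> 'b) \<Rightarrow> 'm \<Rightarrow> 'b) \<Rightarrow> ('m \<Rightarrow> 'b) \<Rightarrow> ('m \<Rightarrow> 'a) \<Rightarrow> 'm \<Rightarrow> 'a" where
  "shape_operator M N f D \<xi> X p = - tangent_part M N f p (D X \<xi> p)"

definition normal_connection ::
  "('m, 'a::euclidean_space, 'y) riemannian_scheme \<Rightarrow> ('n, 'b::euclidean_space, 'z) riemannian_scheme \<Rightarrow>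
   ('m \<Rightarrow> 'n) \<Rightarrow> (('m \<Rightarrow> 'a) \<Rightarrow> ('m \<Rightarrow> 'b) \<Rightarrow> 'm \<Rightarrow> 'b) \<Rightarrow> ('m \<Rightarrow> 'a) \<Rightarrow> ('m \<Rightarrow> 'b) \<Rightarrow> 'm \<Rightarrow> 'b" where
  "normal_connection M N f D X \<xi> p = normal_part M N f p (D X \<xi> p)"

text \<open>A local orthonormal frame around \<open>p\<close>; its members are defined on all of \<open>M\<close>, but only have to
  be orthonormal near \<open>p\<close>.\<close>

definition orthonormal_frame_near ::
  "('m::topological_space, 'a::euclidean_space, 'z) riemannian_scheme \<Rightarrow> 'm \<Rightarrow> (nat \<Rightarrow> 'm \<Rightarrow> 'a) \<Rightarrow> bool" where
  "orthonormal_frame_near M p e \<longleftrightarrow>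
     (\<forall>i<DIM('a). vector_field M (e i)) \<and>
     (\<exists>U. open U \<and> p \<in> U \<and>
        (\<forall>q\<in>U. \<forall>i<DIM('a). \<forall>j<DIM('a). metric M q (e i q) (e j q) = (if i = j then 1 else 0)))"

definition mean_curvature ::
  "('m::topological_space, 'a::euclidean_space, 'y) riemannian_scheme \<Rightarrow>
   ('n, 'b::euclidean_space, 'z) riemannian_scheme \<Rightarrow>
   ('m \<Rightarrow> 'n) \<Rightarrow> (('m \<Rightarrow> 'a) \<Rightarrow> ('m \<Rightarrow> 'b) \<Rightarrow> 'm \<Rightarrow> 'b) \<Rightarrow> 'm \<Rightarrow> 'b" where
  "mean_curvature M N f D p =
     (THE w. \<exists>e. orthonormal_frame_near M p e \<and>
        w = (1 / real DIM('a)) *\<^sub>R (\<Sum>i<DIM('a). second_form M N f D (e i) (e i) p))"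

definition minimal ::
  "('m::topological_space, 'a::euclidean_space, 'y) riemannian_scheme \<Rightarrow>
   ('n, 'b::euclidean_space, 'z) riemannian_scheme \<Rightarrow>
   ('m \<Rightarrow> 'n) \<Rightarrow> (('m \<Rightarrow> 'a) \<Rightarrow> ('m \<Rightarrow> 'b) \<Rightarrow> 'm \<Rightarrow> 'b) \<Rightarrow> bool" where
  "minimal M N f D \<longleftrightarrow> (\<forall>p. mean_curvature M N f D p = 0)"

definition pseudo_umbilical ::
  "('m::topological_space, 'a::euclidean_space, 'y) riemannian_scheme \<Rightarrow>
   ('n, 'b::euclidean_space, 'z) riemannian_scheme \<Rightarrow>
   ('m \<Rightarrow> 'n) \<Rightarrow> (('m \<Rightarrow> 'a) \<Rightarrow> ('m \<Rightarrow> 'b) \<Rightarrow> 'm \<Rightarrow> 'b) \<Rightarrow> bool" where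
  "pseudo_umbilical M N f D \<longleftrightarrow>
     (\<forall>X Y p. vector_field M X \<longrightarrow> vector_field M Y \<longrightarrow>
        metric N (f p) (second_form M N f D X Y p) (mean_curvature M N f D p) =
        metric M p (X p) (Y p) *
          metric N (f p) (mean_curvature M N f D p) (mean_curvature M N f D p))"


section \<open>Submanifolds of locally product manifolds\<close>

definition phi_op ::
  "('m, 'a::euclidean_space) riemannian \<Rightarrow> ('n, 'b::euclidean_space) product_riemannian \<Rightarrow>
   ('m \<Rightarrow> 'n) \<Rightarrow> 'm \<Rightarrow> 'a \<Rightarrow> 'a" where
  "phi_op M N f p u = tangent_part M N f p (prodstr N (f p) (tmap M N f p u))"

definition omega_op ::
  "('m, 'a::euclidean_space) riemannian \<Rightarrow> ('n, 'b::euclidean_space) product_riemannian \<Rightarrow>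
   ('m \<Rightarrow> 'n) \<Rightarrow> 'm \<Rightarrow> 'a \<Rightarrow> 'b" where
  "omega_op M N f p u = normal_part M N f p (prodstr N (f p) (tmap M N f p u))"

definition C_op ::
  "('m, 'a::euclidean_space) riemannian \<Rightarrow> ('n, 'b::euclidean_space) product_riemannian \<Rightarrow>
   ('m \<Rightarrow> 'n) \<Rightarrow> 'm \<Rightarrow> 'b \<Rightarrow> 'b" where
  "C_op M N f p \<xi> = normal_part M N f p (prodstr N (f p) \<xi>)"

definition nabla_omega ::
  "('m, 'a::euclidean_space) riemannian \<Rightarrow> ('n, 'b::euclidean_space) product_riemannian \<Rightarrow>
   ('m \<Rightarrow> 'n) \<Rightarrow> (('m \<Rightarrow> 'a) \<Rightarrow> ('m \<Rightarrow> 'b) \<Rightarrow> 'm \<Rightarrow> 'b) \<Rightarrow> ('m \<Rightarrow> 'a) \<Rightarrow> ('m \<Rightarrow> 'a) \<Rightarrow> 'm \<Rightarrow> 'b" where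
  "nabla_omega M N f D X Y p =
     normal_connection M N f D X (\<lambda>q. omega_op M N f q (Y q)) p - omega_op M N f p (conn M X Y p)"

definition distribution ::
  "('m::topological_space, 'a::euclidean_space, 'z) atlas_scheme \<Rightarrow> nat \<Rightarrow> ('m \<Rightarrow> 'a set) \<Rightarrow> bool" where
  "distribution M k E \<longleftrightarrow>
     (\<forall>p. subspace (E p) \<and> dim (E p) = k) \<and>
     (\<forall>p. \<exists>e U. (\<forall>i<k. vector_field M (e i)) \<and> open U \<and> p \<in> U \<and>
        (\<forall>q\<in>U. E q = span ((\<lambda>i. e i q) ` {..<k})))"

definition semi_invariant_splitting ::
  "('m::topological_space, 'a::euclidean_space) riemannian \<Rightarrow>
   ('n, 'b::euclidean_space) product_riemannian \<Rightarrow>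
   ('m \<Rightarrow> 'n) \<Rightarrow> nat \<Rightarrow> nat \<Rightarrow> ('m \<Rightarrow> 'a set) \<Rightarrow> ('m \<Rightarrow> 'a set) \<Rightarrow> bool" where
  "semi_invariant_splitting M N f k l E E' \<longleftrightarrow>
     distribution M k E \<and> distribution M l E' \<and>
     (\<forall>p. E p \<inter> E' p = {0} \<and> (\<forall>v. \<exists>u\<in>E p. \<exists>w\<in>E' p. v = u + w)) \<and>
     (\<forall>p. prodstr N (f p) ` (tmap M N f p ` E p) = tmap M N f p ` E p) \<and>
     (\<forall>p. \<forall>w\<in>E' p. \<forall>v. metric N (f p) (prodstr N (f p) (tmap M N f p w)) (tmap M N f p v) = 0)"

definition semi_invariant ::
  "('m::topological_space, 'a::euclidean_space) riemannian \<Rightarrow>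
   ('n, 'b::euclidean_space) product_riemannian \<Rightarrow> ('m \<Rightarrow> 'n) \<Rightarrow> bool" where
  "semi_invariant M N f \<longleftrightarrow> (\<exists>k l E E'. semi_invariant_splitting M N f k l E E')"

definition anti_invariant ::
  "('m::topological_space, 'a::euclidean_space) riemannian \<Rightarrow>
   ('n, 'b::euclidean_space) product_riemannian \<Rightarrow> ('m \<Rightarrow> 'n) \<Rightarrow> bool" where
  "anti_invariant M N f \<longleftrightarrow> (\<exists>l E E'. semi_invariant_splitting M N f 0 l E E')"

end

theory Submission
  imports Defs
begin

text \<open>
  Write \<open>D\<close> for the pullback connection, \<open>h\<close> for the second fundamental form and \<open>g\<close> for the metrics.
  Applying \<open>D\<^sub>X\<close> to \<open>F Y = \<phi> Y + \<omega> Y\<close> and using that \<open>F\<close> is parallel, the normal parts give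
  \<open>(\<nabla>\<^sub>X \<omega>) Y = C h (X, Y) - h (X, \<phi> Y)\<close> (\<open>nabla_omega_eq\<close>).  Pair this with \<open>H\<close>.  Since \<open>F\<close>, hence \<open>C\<close>, is
  self-adjoint, the first term is \<open>g (h (X, Y), C H) = g (Y, A\<^bsub>C H\<^esub> X)\<close>; since \<open>M\<close> is pseudo-umbilical, the
  second one is \<open>g (X, \<phi> Y) g (H, H)\<close>.  So the identity says that \<open>g (X, \<phi> Y) g (H, H) = 0\<close> for all \<open>X\<close> and \<open>Y\<close>,
  that is, at each point \<open>H = 0\<close> or \<open>\<phi> = 0\<close> (\<open>omega_identity_iff\<close>).  On a semi-invariant submanifold the kernel
  of \<open>\<phi>\<close> has constant rank, so \<open>\<phi>\<close> vanishes everywhere or nowhere (\<open>phi_zero_iff_rank_zero\<close>), and the pointwise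
  alternative becomes the global one between minimal and anti-invariant.

  Most of the work lies in the facts that this computation takes for granted.  Connections and metrics act on
  global smooth fields, so bump functions are needed to see that they are local (\<open>bump_function\<close>, \<open>D_cong\<close>).
  The properties of \<open>D\<close> -- it is metric, commutes with \<open>F\<close>, and is torsion-free on tangent fields -- are derived
  from those of the connection of \<open>N\<close> by an induction over fields along the immersion (\<open>field_along_induct\<close>).
  Torsion-freeness and metricity identify the tangential part of \<open>D\<^sub>X Y\<close> with \<open>\<nabla>\<^sub>X Y\<close> (\<open>gauss_formula\<close>).
  Finally, local orthonormal frames (\<open>gram_schmidt\<close>) and the independence of the trace of \<open>h\<close> from the frame
  (\<open>trace_second_form_frame_independent\<close>) show that \<open>H\<close> is well defined, and that it is a smooth normal field.
\<close>

section \<open>Calculus of smooth functions\<close>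

lemma Ck_on_cong:
  fixes f g :: "'a::euclidean_space \<Rightarrow> 'c::real_normed_vector"
  assumes "open S" "\<And>x. x \<in> S \<Longrightarrow> f x = g x" "Ck_on k S f"
  shows "Ck_on k S g"
  using assms
proof (induction k arbitrary: f g)
  case 0
  then show ?case using continuous_on_cong[of S S f g] by simp
next
  case (Suc k)
  have d: "(g has_derivative frechet_derivative f (at x)) (at x)" if "x \<in> S" for x
  proof (rule has_derivative_transform_within_open[of f _ _ _ S])
    show "(f has_derivative frechet_derivative f (at x)) (at x)"
      using Suc.prems(3) that frechet_derivative_works by auto
  qed (use Suc.prems that in auto)
  have "Ck_on k S (\<lambda>x. frechet_derivative g (at x) v)" for v
    by (rule Suc.IH[OF \<open>open S\<close>, of "\<lambda>x. frechet_derivative f (at x) v"])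
       (use Suc.prems(3) frechet_derivative_at[OF d] in simp_all)
  then show ?case
    using d by (auto simp: differentiable_def)
qed

lemma Ck_on_SucI:
  fixes f :: "'a::euclidean_space \<Rightarrow> 'c::real_normed_vector"
  assumes "open S" "\<And>x. x \<in> S \<Longrightarrow> (f has_derivative f' x) (at x)" "\<And>v. Ck_on k S (\<lambda>x. f' x v)"
  shows "Ck_on (Suc k) S f"
proof -
  have "Ck_on k S (\<lambda>x. frechet_derivative f (at x) v)" for v
    by (rule Ck_on_cong[OF assms(1) _ assms(3)[of v]])
       (use frechet_derivative_at[OF assms(2)] in simp)
  then show ?thesis
    using assms(2) by (auto simp: differentiable_def)
qed

lemma Ck_on_SucD:
  fixes f :: "'a::euclidean_space \<Rightarrow> 'c::real_normed_vector"
  shows "Ck_on (Suc k) S f \<Longrightarrow> x \<in> S \<Longrightarrow> (f has_derivative frechet_derivative f (at x)) (at x)"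
  by (auto simp: frechet_derivative_works)

lemma Ck_on_lower:
  fixes f :: "'a::euclidean_space \<Rightarrow> 'c::real_normed_vector"
  assumes "Ck_on (Suc k) S f"
  shows "Ck_on k S f"
  using assms
proof (induction k arbitrary: f)
  case 0
  then show ?case
    by (auto intro!: continuous_at_imp_continuous_on differentiable_imp_continuous_within)
qed auto

lemma Ck_on_subset:
  fixes f :: "'a::euclidean_space \<Rightarrow> 'c::real_normed_vector"
  shows "Ck_on k S f \<Longrightarrow> T \<subseteq> S \<Longrightarrow> Ck_on k T f"
  by (induction k arbitrary: f) (auto intro: continuous_on_subset)

lemma Ck_on_local:
  fixes f :: "'a::euclidean_space \<Rightarrow> 'c::real_normed_vector"
  assumes "\<And>x. x \<in> S \<Longrightarrow> \<exists>T. open T \<and> x \<in> T \<and> Ck_on k T f"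
  shows "Ck_on k S f"
  using assms
proof (induction k arbitrary: f)
  case 0
  have "isCont f x" if "x \<in> S" for x
    using 0[OF that] by (auto simp: continuous_on_eq_continuous_at)
  then show ?case by (simp add: continuous_at_imp_continuous_on)
next
  case (Suc k)
  have "Ck_on k S (\<lambda>x. frechet_derivative f (at x) v)" for v
    by (rule Suc.IH) (use Suc.prems in fastforce)
  then show ?case using Suc.prems by fastforce
qed

lemma Ck_on_const [simp]: "Ck_on k S (\<lambda>_::'a::euclidean_space. c::'c::real_normed_vector)"
  by (induction k arbitrary: c) auto

lemma Ck_on_linear:
  fixes L :: "'a::euclidean_space \<Rightarrow> 'c::real_normed_vector"
  assumes "linear L"
  shows "Ck_on k S L"
proof -
  have L: "(L has_derivative L) (at x)" for x
    using assms by (simp add: bounded_linear_imp_has_derivative linear_conv_bounded_linear)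
  show ?thesis
  proof (cases k)
    case 0
    then show ?thesis using assms by (simp add: linear_continuous_on linear_conv_bounded_linear)
  next
    case (Suc j)
    then show ?thesis using L frechet_derivative_at[OF L, symmetric] by (auto simp: differentiable_def)
  qed
qed

lemma Ck_on_add:
  fixes f g :: "'a::euclidean_space \<Rightarrow> 'c::real_normed_vector"
  assumes "open S" "Ck_on k S f" "Ck_on k S g"
  shows "Ck_on k S (\<lambda>x. f x + g x)"
  using assms
proof (induction k arbitrary: f g)
  case 0
  then show ?case by (auto intro: continuous_on_add)
next
  case (Suc k)
  show ?case
    by (rule Ck_on_SucI[OF \<open>open S\<close> has_derivative_add[OF Ck_on_SucD Ck_on_SucD]])
       (use Suc in auto)
qed

lemma Ck_on_bilinear:
  fixes f :: "'a::euclidean_space \<Rightarrow> 'b::real_normed_vector" and g :: "'a \<Rightarrow> 'c::real_normed_vector"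
    and prod :: "'b \<Rightarrow> 'c \<Rightarrow> 'd::real_normed_vector"
  assumes "bounded_bilinear prod" "open S" "Ck_on k S f" "Ck_on k S g"
  shows "Ck_on k S (\<lambda>x. prod (f x) (g x))"
  using assms(3,4)
proof (induction k arbitrary: f g)
  case 0
  then show ?case using bounded_bilinear.continuous_on[OF assms(1)] by auto
next
  case (Suc k)
  show ?case
    by (rule Ck_on_SucI[OF \<open>open S\<close> bounded_bilinear.FDERIV[OF assms(1) Ck_on_SucD[OF Suc.prems(1)] Ck_on_SucD[OF Suc.prems(2)]]])
       (use Suc in \<open>auto intro!: Ck_on_add[OF \<open>open S\<close>] Suc.IH Ck_on_lower[OF Suc.prems(1)]
          Ck_on_lower[OF Suc.prems(2)] simp del: Ck_on.simps simp: Ck_on.simps(2)[of k S f] Ck_on.simps(2)[of k S g]\<close>)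
qed

lemma Ck_on_sum:
  fixes f :: "'i \<Rightarrow> 'a::euclidean_space \<Rightarrow> 'c::real_normed_vector"
  assumes "open S" "\<And>i. i \<in> I \<Longrightarrow> Ck_on k S (f i)"
  shows "Ck_on k S (\<lambda>x. \<Sum>i\<in>I. f i x)"
  using assms(2) by (induction I rule: infinite_finite_induct) (auto intro: Ck_on_add[OF assms(1)])

lemma linear_basis_expansion:
  fixes L :: "'a::euclidean_space \<Rightarrow> 'c::real_vector"
  assumes "linear L"
  shows "L u = (\<Sum>b\<in>Basis. (u \<bullet> b) *\<^sub>R L b)"
proof -
  have "L u = L (\<Sum>b\<in>Basis. (u \<bullet> b) *\<^sub>R b)" by (simp add: euclidean_representation)
  then show ?thesis by (simp add: linear_sum[OF assms] linear_cmul[OF assms])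
qed

text \<open>The chain rule does not stay within compositions; expanding the inner derivative in the standard basis
  turns the derivative of a composition into a sum of products of functions of the same kind, which
  is what the induction on the order needs.\<close>

lemma Ck_on_compose:
  fixes f :: "'a::euclidean_space \<Rightarrow> 'b::euclidean_space" and g :: "'b \<Rightarrow> 'c::real_normed_vector"
  assumes "open S" "f ` S \<subseteq> T" "Ck_on k S f" "Ck_on k T g"
  shows "Ck_on k S (\<lambda>x. g (f x))"
  using assms(3,4)
proof (induction k arbitrary: g)
  case 0
  then show ?case using continuous_on_compose2 assms(2) by auto
next
  case (Suc k)
  have lin: "linear (frechet_derivative g (at (f x)))" if "x \<in> S" for x
    using Suc.prems(2) that assms(2) linear_frechet_derivative by fastforce
  show ?case
  proof (rule Ck_on_SucI[OF \<open>open S\<close>])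
    show "((\<lambda>x. g (f x)) has_derivative
        (\<lambda>v. frechet_derivative g (at (f x)) (frechet_derivative f (at x) v))) (at x)"
      if "x \<in> S" for x
      using diff_chain_at[OF Ck_on_SucD[OF Suc.prems(1) that] Ck_on_SucD[OF Suc.prems(2)]]
        that assms(2) by (auto simp: o_def)
  next
    fix v
    have *: "Ck_on k S (\<lambda>x. \<Sum>b\<in>Basis. (frechet_derivative f (at x) v \<bullet> b) *\<^sub>R frechet_derivative g (at (f x)) b)"
    proof (rule Ck_on_sum[OF \<open>open S\<close>])
      fix b :: 'b
      have "Ck_on k S (\<lambda>x. frechet_derivative f (at x) v \<bullet> b)"
        using Ck_on_bilinear[OF bounded_bilinear_inner \<open>open S\<close>, of k _ "\<lambda>_. b"] Suc.prems(1) by simp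
      moreover have "Ck_on k S (\<lambda>x. frechet_derivative g (at (f x)) b)"
        using Suc.IH[of "\<lambda>y. frechet_derivative g (at y) b"] Suc.prems Ck_on_lower[OF Suc.prems(1)] by simp
      ultimately show "Ck_on k S (\<lambda>x. (frechet_derivative f (at x) v \<bullet> b) *\<^sub>R frechet_derivative g (at (f x)) b)"
        by (rule Ck_on_bilinear[OF bounded_bilinear_scaleR \<open>open S\<close>])
    qed
    show "Ck_on k S (\<lambda>x. frechet_derivative g (at (f x)) (frechet_derivative f (at x) v))"
      by (rule Ck_on_cong[OF \<open>open S\<close> _ *]) (simp add: linear_basis_expansion[OF lin, symmetric])
  qed
qed

lemma smooth_on_cong:
  fixes f g :: "'a::euclidean_space \<Rightarrow> 'c::real_normed_vector"
  shows "open S \<Longrightarrow> (\<And>x. x \<in> S \<Longrightarrow> f x = g x) \<Longrightarrow> smooth_on S f \<Longrightarrow> smooth_on S g"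
  unfolding smooth_on_def using Ck_on_cong by blast

lemma smooth_on_subset:
  fixes f :: "'a::euclidean_space \<Rightarrow> 'c::real_normed_vector"
  shows "smooth_on S f \<Longrightarrow> T \<subseteq> S \<Longrightarrow> smooth_on T f"
  unfolding smooth_on_def using Ck_on_subset by blast

lemma smooth_on_local:
  fixes f :: "'a::euclidean_space \<Rightarrow> 'c::real_normed_vector"
  shows "(\<And>x. x \<in> S \<Longrightarrow> \<exists>T. open T \<and> x \<in> T \<and> smooth_on T f) \<Longrightarrow> smooth_on S f"
  unfolding smooth_on_def by (metis Ck_on_local)

lemma smooth_on_const [simp]: "smooth_on S (\<lambda>_::'a::euclidean_space. c::'c::real_normed_vector)"
  by (simp add: smooth_on_def)

lemma smooth_on_linear:
  fixes L :: "'a::euclidean_space \<Rightarrow> 'c::real_normed_vector"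
  shows "linear L \<Longrightarrow> smooth_on S L"
  by (simp add: smooth_on_def Ck_on_linear)

lemma smooth_on_id: "smooth_on S (\<lambda>x::'a::euclidean_space. x)"
  by (simp add: smooth_on_linear linear_id[unfolded id_def])

lemma smooth_on_add:
  fixes f g :: "'a::euclidean_space \<Rightarrow> 'c::real_normed_vector"
  shows "open S \<Longrightarrow> smooth_on S f \<Longrightarrow> smooth_on S g \<Longrightarrow> smooth_on S (\<lambda>x. f x + g x)"
  by (simp add: smooth_on_def Ck_on_add)

lemma smooth_on_sum:
  fixes f :: "'i \<Rightarrow> 'a::euclidean_space \<Rightarrow> 'c::real_normed_vector"
  shows "open S \<Longrightarrow> (\<And>i. i \<in> I \<Longrightarrow> smooth_on S (f i)) \<Longrightarrow> smooth_on S (\<lambda>x. \<Sum>i\<in>I. f i x)"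
  by (simp add: smooth_on_def Ck_on_sum)

lemma smooth_on_bilinear:
  fixes f :: "'a::euclidean_space \<Rightarrow> 'b::real_normed_vector" and g :: "'a \<Rightarrow> 'c::real_normed_vector"
    and prod :: "'b \<Rightarrow> 'c \<Rightarrow> 'd::real_normed_vector"
  shows "bounded_bilinear prod \<Longrightarrow> open S \<Longrightarrow> smooth_on S f \<Longrightarrow> smooth_on S g \<Longrightarrow>
    smooth_on S (\<lambda>x. prod (f x) (g x))"
  by (simp add: smooth_on_def Ck_on_bilinear)

lemmas smooth_on_scaleR = smooth_on_bilinear[OF bounded_bilinear_scaleR]
lemmas smooth_on_mult = smooth_on_bilinear[OF bounded_bilinear_mult]
lemmas smooth_on_inner = smooth_on_bilinear[OF bounded_bilinear_inner]

lemma smooth_on_compose: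
  fixes f :: "'a::euclidean_space \<Rightarrow> 'b::euclidean_space" and g :: "'b \<Rightarrow> 'c::real_normed_vector"
  shows "open S \<Longrightarrow> f ` S \<subseteq> T \<Longrightarrow> smooth_on S f \<Longrightarrow> smooth_on T g \<Longrightarrow> smooth_on S (\<lambda>x. g (f x))"
  by (simp add: smooth_on_def Ck_on_compose)

lemma smooth_on_has_derivative:
  fixes f :: "'a::euclidean_space \<Rightarrow> 'c::real_normed_vector"
  shows "smooth_on S f \<Longrightarrow> x \<in> S \<Longrightarrow> (f has_derivative frechet_derivative f (at x)) (at x)"
  using Ck_on_SucD smooth_on_def by blast

lemma smooth_on_frechet_derivative:
  fixes f :: "'a::euclidean_space \<Rightarrow> 'c::real_normed_vector"
  shows "smooth_on S f \<Longrightarrow> smooth_on S (\<lambda>x. frechet_derivative f (at x) v)"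
  by (metis Ck_on.simps(2) smooth_on_def)

lemma smooth_on_continuous:
  fixes f :: "'a::euclidean_space \<Rightarrow> 'c::real_normed_vector"
  shows "smooth_on S f \<Longrightarrow> continuous_on S f"
  by (metis Ck_on.simps(1) smooth_on_def)

text \<open>Changes of components, differentials of maps and derivatives of functions along fields all have,
  in charts, the form of a derivative \<open>Dg\<close> at \<open>f x\<close> that is applied to a vector \<open>v x\<close>.\<close>

lemma smooth_on_derivative_apply:
  fixes f :: "'a::euclidean_space \<Rightarrow> 'b::euclidean_space" and v :: "'a \<Rightarrow> 'b"
    and g :: "'b \<Rightarrow> 'c::real_normed_vector"
  assumes "open S" "f ` S \<subseteq> T" "smooth_on S f" "smooth_on T g" "smooth_on S v"
  shows "smooth_on S (\<lambda>x. frechet_derivative g (at (f x)) (v x))"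
proof -
  have lin: "linear (frechet_derivative g (at (f x)))" if "x \<in> S" for x
    using smooth_on_has_derivative[OF assms(4), of "f x"] that assms(2) has_derivative_linear by blast
  have *: "smooth_on S (\<lambda>x. \<Sum>b\<in>Basis. (v x \<bullet> b) *\<^sub>R frechet_derivative g (at (f x)) b)"
    by (intro smooth_on_sum smooth_on_scaleR smooth_on_inner assms smooth_on_const
        smooth_on_compose[OF assms(1-3)] smooth_on_frechet_derivative)
  show ?thesis
    by (rule smooth_on_cong[OF assms(1) _ *]) (simp add: linear_basis_expansion[OF lin, symmetric])
qed

text \<open>Inverses and inverse square roots of positive functions are the cases needed; arbitrary exponents
  and a constant factor make the induction on the order go through.\<close>

lemma smooth_on_powr: "smooth_on {0<..} (\<lambda>x::real. c * x powr a)"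
proof -
  have "Ck_on k {0<..} (\<lambda>x::real. c * x powr a)" for k
  proof (induction k arbitrary: c a)
    case 0
    then show ?case by (auto intro!: continuous_intros)
  next
    case (Suc k)
    have d: "((\<lambda>x. c * x powr a) has_derivative (\<lambda>v. v * (c * (a * x powr (a - 1))))) (at x)"
      if "x > 0" for x :: real
      using that by (auto intro!: derivative_eq_intros simp: powr_diff field_simps)
    show ?case
    proof (rule Ck_on_SucI[where f' = "\<lambda>x v. v * (c * (a * x powr (a - 1)))"])
      show "Ck_on k {0<..} (\<lambda>x. v * (c * (a * x powr (a - 1))))" for v
        using Suc.IH[of "v * c * a" "a - 1"] by (simp add: mult.assoc)
    qed (use d in auto)
  qed
  then show ?thesis by (simp add: smooth_on_def)
qed

text \<open>Smooth functions with prescribed supports come from \<open>exp (- 1 / x)\<close>.  Its derivatives are its products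
  with polynomials in \<open>1 / x\<close>; allowing such a factor from the start makes the class closed under
  differentiation, also at \<open>0\<close>, because the exponential beats every polynomial.\<close>

definition flat_exp :: "real poly \<Rightarrow> real \<Rightarrow> real" where
  "flat_exp P x = (if x > 0 then poly P (1 / x) * exp (- (1 / x)) else 0)"

lemma poly_times_exp_uminus_tendsto: "((\<lambda>t. poly P t * exp (- t)) \<longlongrightarrow> (0::real)) at_top"
proof -
  have "((\<lambda>t. \<Sum>i\<le>degree P. coeff P i * (t ^ i / exp t)) \<longlongrightarrow> (\<Sum>i\<le>degree P. coeff P i * 0)) at_top"
    by (intro tendsto_intros tendsto_power_div_exp_0)
  moreover have "(\<Sum>i\<le>degree P. coeff P i * (t ^ i / exp t)) = poly P t * exp (- t)" for t
    by (simp add: poly_altdef sum_distrib_right exp_minus divide_inverse mult.assoc)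
  ultimately show ?thesis by simp
qed

lemma flat_exp_quotient_tendsto: "((\<lambda>x. flat_exp P x / x) \<longlongrightarrow> 0) (at 0)"
proof -
  have "((\<lambda>x. poly (pCons 0 P) (inverse x) * exp (- (inverse x))) \<longlongrightarrow> 0) (at_right (0::real))"
    using filterlim_compose[OF poly_times_exp_uminus_tendsto filterlim_inverse_at_top_right] .
  then have "((\<lambda>x. flat_exp P x / x) \<longlongrightarrow> 0) (at_right 0)"
    by (rule Lim_transform_eventually)
       (auto simp: eventually_at_filter flat_exp_def field_simps)
  moreover have "((\<lambda>x. flat_exp P x / x) \<longlongrightarrow> 0) (at_left 0)"
    by (rule Lim_transform_eventually[OF tendsto_const])
       (auto simp: eventually_at_filter flat_exp_def)
  ultimately show ?thesis by (simp add: filterlim_split_at)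
qed

lemma flat_exp_has_derivative:
  "(flat_exp P has_real_derivative flat_exp ([:0, 0, 1:] * (P - pderiv P)) x) (at x)"
proof -
  consider "x > 0" | "x < 0" | "x = 0" by linarith
  then show ?thesis
  proof cases
    case 1
    have "((\<lambda>x. poly P (1 / x) * exp (- (1 / x))) has_real_derivative
        flat_exp ([:0, 0, 1:] * (P - pderiv P)) x) (at x)"
      using 1 by (auto intro!: derivative_eq_intros DERIV_chain'[OF _ poly_DERIV]
          simp: flat_exp_def field_simps power2_eq_square)
    then show ?thesis
      by (rule has_field_derivative_transform_within_open[of _ _ _ "{0<..}"])
         (use 1 in \<open>auto simp: flat_exp_def\<close>)
  next
    case 2
    have "((\<lambda>x. 0) has_real_derivative flat_exp ([:0, 0, 1:] * (P - pderiv P)) x) (at x)"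
      using 2 by (simp add: flat_exp_def)
    then show ?thesis
      by (rule has_field_derivative_transform_within_open[of _ _ _ "{..<0}"])
         (use 2 in \<open>auto simp: flat_exp_def\<close>)
  next
    case 3
    then show ?thesis
      using flat_exp_quotient_tendsto[of P] by (simp add: has_field_derivative_iff flat_exp_def)
  qed
qed

lemma smooth_on_flat_exp: "smooth_on S (flat_exp P)"
proof -
  have "Ck_on k UNIV (\<lambda>x. c * flat_exp P x)" for k c
  proof (induction k arbitrary: P c)
    case 0
    have "isCont (flat_exp P) x" for x by (rule DERIV_isCont[OF flat_exp_has_derivative])
    then show ?case by (auto intro!: continuous_intros continuous_at_imp_continuous_on)
  next
    case (Suc k)
    have d: "((\<lambda>x. c * flat_exp P x) has_derivative (\<lambda>v. (c * v) * flat_exp ([:0, 0, 1:] * (P - pderiv P)) x)) (at x)"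
      for x
      using DERIV_cmult[OF flat_exp_has_derivative[of P x], of c]
      unfolding has_field_derivative_def by (rule has_derivative_eq_rhs) (simp add: fun_eq_iff)
    show ?case
      by (rule Ck_on_SucI[where f' = "\<lambda>x v. (c * v) * flat_exp ([:0, 0, 1:] * (P - pderiv P)) x"])
         (use d Suc in auto)
  qed
  from this[of _ 1] show ?thesis using smooth_on_subset[of UNIV "flat_exp P" S]
    by (simp add: smooth_on_def)
qed

lemma flat_exp_1: "flat_exp 1 x \<ge> 0" "flat_exp 1 x > 0 \<longleftrightarrow> x > 0"
  by (auto simp: flat_exp_def)

text \<open>The quotient of a flat function by the sum of two flat functions that are never both zero
  steps smoothly from \<open>1\<close> to \<open>0\<close> between \<open>1\<close> and \<open>2\<close>.\<close>

definition smooth_step :: "real \<Rightarrow> real" where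
  "smooth_step t = flat_exp 1 (2 - t) * (flat_exp 1 (2 - t) + flat_exp 1 (t - 1)) powr (-1)"

lemma smooth_step_values: "t \<le> 1 \<Longrightarrow> smooth_step t = 1" "t \<ge> 2 \<Longrightarrow> smooth_step t = 0"
  by (auto simp: smooth_step_def flat_exp_def powr_minus)

lemma smooth_on_smooth_step: "smooth_on UNIV smooth_step"
proof -
  have pos: "flat_exp 1 (2 - t) + flat_exp 1 (t - 1) > 0" for t
    using flat_exp_1(1)[of "2 - t"] flat_exp_1(1)[of "t - 1"] flat_exp_1(2)[of "2 - t"] flat_exp_1(2)[of "t - 1"]
    by (cases "t < 2") linarith+
  have aff: "smooth_on UNIV (\<lambda>t::real. a + b * t)" for a b
    by (intro smooth_on_add smooth_on_mult smooth_on_const smooth_on_id open_UNIV)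
  have 1: "smooth_on UNIV (\<lambda>t. flat_exp 1 (2 - t))"
    using smooth_on_compose[OF open_UNIV subset_UNIV aff smooth_on_flat_exp, of "[:1:]" 2 "-1"] by (simp add: one_pCons)
  have 2: "smooth_on UNIV (\<lambda>t. flat_exp 1 (t - 1))"
    using smooth_on_compose[OF open_UNIV subset_UNIV aff smooth_on_flat_exp, of "[:1:]" "-1" 1] by (simp add: one_pCons)
  have "smooth_on UNIV (\<lambda>t. 1 * (flat_exp 1 (2 - t) + flat_exp 1 (t - 1)) powr (-1))"
    by (rule smooth_on_compose[where f = "\<lambda>t. flat_exp 1 (2 - t) + flat_exp 1 (t - 1)", OF _ _ _ smooth_on_powr]) (use pos in \<open>auto intro!: smooth_on_add 1 2\<close>)
  then have "smooth_on UNIV (\<lambda>t. flat_exp 1 (2 - t) * (1 * (flat_exp 1 (2 - t) + flat_exp 1 (t - 1)) powr (-1)))"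
    by (rule smooth_on_mult[OF open_UNIV 1])
  then show ?thesis unfolding smooth_step_def[abs_def] by simp
qed


section \<open>Smoothness near a point\<close>

text \<open>Germs instead of domains: with a pointwise notion of smoothness, gluing is immediate and the domains
  of charts and of their overlaps only enter through \<open>eventually\<close>.\<close>

definition smooth_near :: "('a::euclidean_space \<Rightarrow> 'c::real_normed_vector) \<Rightarrow> 'a \<Rightarrow> bool" where
  "smooth_near f x \<longleftrightarrow> (\<exists>S. open S \<and> x \<in> S \<and> smooth_on S f)"

lemma smooth_nearI: "smooth_on S f \<Longrightarrow> open S \<Longrightarrow> x \<in> S \<Longrightarrow> smooth_near f x"
  unfolding smooth_near_def by blast

lemma smooth_on_iff_smooth_near: "open S \<Longrightarrow> smooth_on S f \<longleftrightarrow> (\<forall>x\<in>S. smooth_near f x)"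
  unfolding smooth_near_def using smooth_on_local[of S f] by blast

lemma smooth_near_cong:
  assumes "\<forall>\<^sub>F y in nhds x. f y = g y" "smooth_near f x"
  shows "smooth_near g x"
proof -
  obtain S T where "open S" "x \<in> S" "\<forall>y\<in>S. f y = g y" "open T" "x \<in> T" "smooth_on T f"
    using assms by (auto simp: eventually_nhds smooth_near_def)
  then show ?thesis
    by (intro smooth_nearI[of "S \<inter> T"] smooth_on_cong[of "S \<inter> T" f g] smooth_on_subset[of T f "S \<inter> T"]) auto
qed

lemma smooth_near_eventually: "smooth_near f x \<Longrightarrow> \<forall>\<^sub>F y in nhds x. smooth_near f y"
  unfolding smooth_near_def eventually_nhds by blast

lemma smooth_near_const [simp]: "smooth_near (\<lambda>_. c) x"
  by (rule smooth_nearI[of UNIV]) auto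

lemma smooth_near_id [simp]: "smooth_near (\<lambda>x. x) x"
  by (rule smooth_nearI[of UNIV]) (auto simp: smooth_on_id)

lemma smooth_near_both:
  assumes "smooth_near f x" "smooth_near g x"
  obtains S where "open S" "x \<in> S" "smooth_on S f" "smooth_on S g"
proof -
  obtain S T where "open S" "x \<in> S" "smooth_on S f" "open T" "x \<in> T" "smooth_on T g"
    using assms by (auto simp: smooth_near_def)
  then show ?thesis
    by (intro that[of "S \<inter> T"] smooth_on_subset[of S f "S \<inter> T"] smooth_on_subset[of T g "S \<inter> T"]) auto
qed

lemma smooth_near_add: "smooth_near f x \<Longrightarrow> smooth_near g x \<Longrightarrow> smooth_near (\<lambda>x. f x + g x) x"
  by (erule (1) smooth_near_both) (auto intro: smooth_nearI smooth_on_add)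

lemma smooth_near_scaleR: "smooth_near f x \<Longrightarrow> smooth_near g x \<Longrightarrow> smooth_near (\<lambda>x. f x *\<^sub>R g x) x"
  by (erule (1) smooth_near_both) (auto intro: smooth_nearI smooth_on_scaleR)

lemma smooth_near_inner: "smooth_near f x \<Longrightarrow> smooth_near g x \<Longrightarrow> smooth_near (\<lambda>x. f x \<bullet> g x) x"
  by (erule (1) smooth_near_both) (auto intro: smooth_nearI smooth_on_inner)

lemma smooth_near_has_derivative:
  "smooth_near f x \<Longrightarrow> (f has_derivative frechet_derivative f (at x)) (at x)"
  unfolding smooth_near_def using smooth_on_has_derivative by blast

lemma smooth_near_isCont: "smooth_near f x \<Longrightarrow> isCont f x"
  by (rule has_derivative_continuous[OF smooth_near_has_derivative])

lemma smooth_near_linear: "smooth_near f x \<Longrightarrow> linear (frechet_derivative f (at x))"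
  using smooth_near_has_derivative has_derivative_linear by blast

lemma smooth_near_shrink:
  fixes f :: "'a::euclidean_space \<Rightarrow> 'b::euclidean_space"
  assumes "smooth_near f x" "open T" "f x \<in> T"
  obtains S where "open S" "x \<in> S" "f ` S \<subseteq> T" "smooth_on S f"
proof -
  obtain S where S: "open S" "x \<in> S" "smooth_on S f"
    using assms(1) by (auto simp: smooth_near_def)
  have "open (S \<inter> f -` T)"
    using smooth_on_continuous[OF S(3)] S(1) assms(2) by (simp add: continuous_on_open_vimage Int_commute)
  then show ?thesis
    using that[of "S \<inter> f -` T"] S assms(3) smooth_on_subset[OF S(3), of "S \<inter> f -` T"] by auto
qed

lemma smooth_near_compose:
  fixes f :: "'a::euclidean_space \<Rightarrow> 'b::euclidean_space"
  assumes "smooth_near f x" "smooth_near g (f x)"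
  shows "smooth_near (\<lambda>x. g (f x)) x"
proof -
  obtain T where T: "open T" "f x \<in> T" "smooth_on T g"
    using assms(2) by (auto simp: smooth_near_def)
  obtain S where "open S" "x \<in> S" "f ` S \<subseteq> T" "smooth_on S f"
    by (rule smooth_near_shrink[OF assms(1) T(1,2)])
  then show ?thesis
    using smooth_on_compose[OF _ _ _ T(3)] by (blast intro: smooth_nearI)
qed

lemma smooth_near_derivative_apply:
  fixes f :: "'a::euclidean_space \<Rightarrow> 'b::euclidean_space" and g :: "'b \<Rightarrow> 'c::real_normed_vector"
  assumes "smooth_near f x" "smooth_near g (f x)" "smooth_near v x"
  shows "smooth_near (\<lambda>x. frechet_derivative g (at (f x)) (v x)) x"
proof -
  obtain T where T: "open T" "f x \<in> T" "smooth_on T g"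
    using assms(2) by (auto simp: smooth_near_def)
  obtain S where S: "open S" "x \<in> S" "f ` S \<subseteq> T" "smooth_on S f"
    by (rule smooth_near_shrink[OF assms(1) T(1,2)])
  obtain R where R: "open R" "x \<in> R" "smooth_on R f" "smooth_on R v"
    by (rule smooth_near_both[OF assms(1,3)])
  have "smooth_on (S \<inter> R) (\<lambda>x. frechet_derivative g (at (f x)) (v x))"
    using S R by (intro smooth_on_derivative_apply[OF _ _ _ T(3)]) (auto intro: smooth_on_subset)
  then show ?thesis
    using S R by (intro smooth_nearI[of "S \<inter> R"]) auto
qed

lemma frechet_derivative_cong_near:
  assumes "\<forall>\<^sub>F y in nhds x. f y = g y" "smooth_near f x"
  shows "frechet_derivative f (at x) = frechet_derivative g (at x)"
proof -
  obtain S where "open S" "x \<in> S" "\<forall>y\<in>S. f y = g y"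
    using assms(1) by (auto simp: eventually_nhds)
  then show ?thesis
    using has_derivative_transform_within_open[OF smooth_near_has_derivative[OF assms(2)], of S g]
    by (intro frechet_derivative_at) auto
qed

lemma frechet_derivative_chain:
  assumes "smooth_near f x" "smooth_near g (f x)"
  shows "frechet_derivative (\<lambda>x. g (f x)) (at x) v =
    frechet_derivative g (at (f x)) (frechet_derivative f (at x) v)"
  using frechet_derivative_at[OF diff_chain_at[OF assms[THEN smooth_near_has_derivative]]]
  by (simp add: o_def fun_eq_iff)


section \<open>Charts, functions and fields near a point\<close>

locale manifold =
  fixes M :: "('m::{t2_space,second_countable_topology}, 'a::euclidean_space, 'z) atlas_scheme"
  assumes smooth_manifold: "smooth_manifold M"
begin

lemma mem_cdom [simp]: "p \<in> cdom M p"
  and open_cdom [simp]: "open (cdom M p)"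
  and open_coord_image: "open (coord M p ` cdom M p)"
  and chart_homeomorphism: "homeomorphism (cdom M p) (coord M p ` cdom M p) (coord M p) (cinv M p)"
  and smooth_on_transition: "smooth_on (coord M p ` (cdom M p \<inter> cdom M q)) (\<lambda>x. coord M q (cinv M p x))"
  using smooth_manifold unfolding smooth_manifold_def by blast+

lemma cinv_coord [simp]: "r \<in> cdom M p \<Longrightarrow> cinv M p (coord M p r) = r"
  using chart_homeomorphism[of p] by (simp add: homeomorphism_def)

lemma open_coord_image_of: "open U \<Longrightarrow> U \<subseteq> cdom M p \<Longrightarrow> open (coord M p ` U)"
  using homeomorphism_imp_open_map[OF chart_homeomorphism[of p], of U]
    openin_open_eq[OF open_coord_image, of p "coord M p ` U"] by (simp add: open_subset)

lemma eventually_in_chart: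
  assumes "r \<in> cdom M p" "\<forall>\<^sub>F q in nhds r. P q"
  shows "\<forall>\<^sub>F x in nhds (coord M p r). P (cinv M p x) \<and> cinv M p x \<in> cdom M p \<and> coord M p (cinv M p x) = x"
proof -
  obtain U where U: "open U" "r \<in> U" "\<forall>q\<in>U. P q"
    using assms(2) by (auto simp: eventually_nhds)
  show ?thesis
    unfolding eventually_nhds
    by (rule exI[of _ "coord M p ` (U \<inter> cdom M p)"])
       (use U assms(1) in \<open>auto intro!: open_coord_image_of open_Int\<close>)
qed

lemma isCont_coord: "r \<in> cdom M p \<Longrightarrow> isCont (coord M p) r"
  using chart_homeomorphism[of p] by (auto simp: homeomorphism_def continuous_on_eq_continuous_at)

lemma eventually_in_cdom: "r \<in> cdom M p \<Longrightarrow> \<forall>\<^sub>F q in nhds r. q \<in> cdom M p"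
  by (simp add: eventually_nhds_in_open)

lemma eventually_from_chart:
  assumes "r \<in> cdom M p" "\<forall>\<^sub>F x in nhds (coord M p r). P x"
  shows "\<forall>\<^sub>F q in nhds r. P (coord M p q)"
proof -
  have "(coord M p \<longlongrightarrow> coord M p r) (nhds r)"
    using isCont_coord[OF assms(1)] by (simp add: isCont_def tendsto_at_iff_tendsto_nhds)
  then show ?thesis using assms(2) by (simp add: filterlim_iff)
qed

lemma smooth_near_transition:
  assumes "r \<in> cdom M p" "r \<in> cdom M q"
  shows "smooth_near (\<lambda>x. coord M q (cinv M p x)) (coord M p r)"
  by (rule smooth_nearI[OF smooth_on_transition]) (use assms in \<open>auto intro!: open_coord_image_of open_Int\<close>)

lemma linear_tchange: "r \<in> cdom M p \<Longrightarrow> r \<in> cdom M q \<Longrightarrow> linear (tchange M p q r)"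
  unfolding tchange_def by (rule smooth_near_linear[OF smooth_near_transition])

lemma tchange_self [simp]: "r \<in> cdom M p \<Longrightarrow> tchange M p p r u = u"
  unfolding tchange_def
  by (subst frechet_derivative_cong_near[symmetric, of "\<lambda>x. x"])
     (auto intro: eventually_mono[OF eventually_in_chart[of r p "\<lambda>_. True"]])

lemma tchange_tchange:
  assumes "r \<in> cdom M p" "r \<in> cdom M q" "r \<in> cdom M s"
  shows "tchange M q s r (tchange M p q r u) = tchange M p s r u"
proof -
  have "tchange M p s r = frechet_derivative (\<lambda>x. coord M s (cinv M q (coord M q (cinv M p x)))) (at (coord M p r))"
    unfolding tchange_def
    by (rule frechet_derivative_cong_near)
       (use assms eventually_in_chart[OF assms(1) eventually_in_cdom[OF assms(2)]] in
         \<open>auto intro: smooth_near_transition elim!: eventually_mono\<close>)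
  then show ?thesis
    using frechet_derivative_chain[of "\<lambda>x. coord M q (cinv M p x)" "coord M p r" "\<lambda>y. coord M s (cinv M q y)" u]
      assms by (simp add: smooth_near_transition tchange_def)
qed

definition smooth_fun_near :: "('m \<Rightarrow> real) \<Rightarrow> 'm \<Rightarrow> bool" where
  "smooth_fun_near h p \<longleftrightarrow> smooth_near (\<lambda>x. h (cinv M p x)) (coord M p p)"

lemma smooth_near_change_chart:
  fixes h :: "'m \<Rightarrow> 'c::real_normed_vector"
  assumes "r \<in> cdom M p" "r \<in> cdom M q" "smooth_near (\<lambda>x. h (cinv M p x)) (coord M p r)"
  shows "smooth_near (\<lambda>x. h (cinv M q x)) (coord M q r)"
proof (rule smooth_near_cong)
  show "smooth_near (\<lambda>x. h (cinv M p (coord M p (cinv M q x)))) (coord M q r)"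
    by (rule smooth_near_compose[OF smooth_near_transition]) (use assms in auto)
  show "\<forall>\<^sub>F x in nhds (coord M q r). h (cinv M p (coord M p (cinv M q x))) = h (cinv M q x)"
    using eventually_in_chart[OF assms(2) eventually_in_cdom[OF assms(1)]] by (auto elim!: eventually_mono)
qed

lemma smooth_fun_near_chart:
  "r \<in> cdom M p \<Longrightarrow> smooth_fun_near h r \<longleftrightarrow> smooth_near (\<lambda>x. h (cinv M p x)) (coord M p r)"
  unfolding smooth_fun_near_def using smooth_near_change_chart[of r r p h] smooth_near_change_chart[of r p r h]
  by auto

lemma smooth_fun_iff: "smooth_fun M h \<longleftrightarrow> (\<forall>p. smooth_fun_near h p)"
proof -
  have "smooth_fun M h \<longleftrightarrow> (\<forall>p. \<forall>r\<in>cdom M p. smooth_near (\<lambda>x. h (cinv M p x)) (coord M p r))"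
    by (simp add: smooth_fun_def smooth_on_iff_smooth_near[OF open_coord_image])
  also have "\<dots> \<longleftrightarrow> (\<forall>p. \<forall>r\<in>cdom M p. smooth_fun_near h r)"
    by (simp add: smooth_fun_near_chart)
  also have "\<dots> \<longleftrightarrow> (\<forall>p. smooth_fun_near h p)"
    using mem_cdom by blast
  finally show ?thesis .
qed

lemma smooth_fun_nearD: "smooth_fun M h \<Longrightarrow> smooth_fun_near h p"
  by (simp add: smooth_fun_iff)

lemma smooth_fun_near_eventually:
  assumes "smooth_fun_near h p" shows "\<forall>\<^sub>F q in nhds p. smooth_fun_near h q"
  using eventually_conj[OF eventually_in_cdom[of p p] eventually_from_chart[of p p,
        OF mem_cdom smooth_near_eventually[OF assms[unfolded smooth_fun_near_def]]]]
  by (auto simp: smooth_fun_near_chart elim!: eventually_mono)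

lemma smooth_fun_near_cong:
  assumes "\<forall>\<^sub>F q in nhds p. h q = k q" "smooth_fun_near h p"
  shows "smooth_fun_near k p"
  using assms(2) eventually_in_chart[OF mem_cdom assms(1)] unfolding smooth_fun_near_def
  by (elim smooth_near_cong[rotated]) (auto elim!: eventually_mono)

lemma smooth_fun_near_const [simp]: "smooth_fun_near (\<lambda>_. c) p"
  by (simp add: smooth_fun_near_def)

lemma smooth_fun_near_add:
  "smooth_fun_near h p \<Longrightarrow> smooth_fun_near k p \<Longrightarrow> smooth_fun_near (\<lambda>q. h q + k q) p"
  unfolding smooth_fun_near_def by (rule smooth_near_add)

lemma smooth_fun_near_mult:
  "smooth_fun_near h p \<Longrightarrow> smooth_fun_near k p \<Longrightarrow> smooth_fun_near (\<lambda>q. h q * k q) p"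
  unfolding smooth_fun_near_def real_scaleR_def[symmetric] by (rule smooth_near_scaleR)

lemma smooth_fun_near_compose:
  fixes g :: "real \<Rightarrow> real"
  shows "smooth_fun_near h p \<Longrightarrow> smooth_near g (h p) \<Longrightarrow> smooth_fun_near (\<lambda>q. g (h q)) p"
  unfolding smooth_fun_near_def by (rule smooth_near_compose) auto

lemmas smooth_fun_const = smooth_fun_iff[THEN iffD2, OF allI, OF smooth_fun_near_const]

text \<open>The Hausdorff property is essential here: the support of the bump function in the chart is compact,
  and being compact it is closed in the manifold.  So its extension by zero is smooth.\<close>

lemma bump_function:
  assumes "open U" "p \<in> U"
  obtains \<eta> K where "smooth_fun M \<eta>" "\<forall>\<^sub>F q in nhds p. \<eta> q = 1" "closed K" "K \<subseteq> U" "\<And>q. q \<notin> K \<Longrightarrow> \<eta> q = 0"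
proof -
  define c where "c = coord M p p"
  have "open (coord M p ` (cdom M p \<inter> U))" "c \<in> coord M p ` (cdom M p \<inter> U)"
    using assms by (auto intro!: open_coord_image_of simp: c_def)
  then obtain e0 where e0: "e0 > 0" "cball c e0 \<subseteq> coord M p ` (cdom M p \<inter> U)"
    using open_contains_cball by blast
  \<comment> \<open>The step function drops from \<open>1\<close> to \<open>0\<close> while the squared distance grows from \<open>e\<^sup>2\<close> to
    \<open>2 * e\<^sup>2\<close>, so within the ball of radius \<open>2 * e\<close>.\<close>
  define e where "e = e0 / 2"
  have e: "e > 0" "cball c (2 * e) \<subseteq> coord M p ` (cdom M p \<inter> U)"
    using e0 by (auto simp: e_def)
  define \<beta> where "\<beta> x = smooth_step (((x - c) \<bullet> (x - c)) *\<^sub>R (1 / e\<^sup>2))" for x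
  define \<eta> where "\<eta> q = (if q \<in> cdom M p then \<beta> (coord M p q) else 0)" for q
  define K where "K = cinv M p ` cball c (2 * e)"
  have K_cdom: "K \<subseteq> cdom M p \<inter> U"
    using e(2) by (force simp: K_def)
  have "continuous_on (cball c (2 * e)) (cinv M p)"
  proof (rule continuous_on_subset)
    show "continuous_on (coord M p ` cdom M p) (cinv M p)"
      using chart_homeomorphism[of p] by (simp add: homeomorphism_def)
  qed (use e(2) in auto)
  then have "closed K"
    unfolding K_def by (intro compact_imp_closed compact_continuous_image) auto
  have \<beta>_smooth: "smooth_near \<beta> x" for x
  proof -
    have *: "smooth_near (\<lambda>x. x + (- c)) x"
      by (intro smooth_near_add) auto
    have "smooth_near smooth_step t" for t
      by (rule smooth_nearI[OF smooth_on_smooth_step]) auto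
    moreover have "smooth_near (\<lambda>x. ((x + - c) \<bullet> (x + - c)) *\<^sub>R (1 / e\<^sup>2)) x"
      by (intro smooth_near_scaleR smooth_near_inner * smooth_near_const)
    ultimately have "smooth_near (\<lambda>x. smooth_step (((x + - c) \<bullet> (x + - c)) *\<^sub>R (1 / e\<^sup>2))) x"
      by (rule smooth_near_compose[rotated])
    then show ?thesis by (simp add: \<beta>_def[abs_def])
  qed
  have \<beta>_0: "\<beta> x = 0" if "x \<notin> cball c (2 * e)" for x
  proof -
    have "2 * e < norm (x - c)" using that by (simp add: dist_norm norm_minus_commute)
    then have "(2 * e)\<^sup>2 \<le> (norm (x - c))\<^sup>2" using e(1) by (intro power_mono) auto
    then have "2 * e\<^sup>2 \<le> (norm (x - c))\<^sup>2" by (simp add: power_mult_distrib) (smt (verit) zero_le_power2)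
    then show ?thesis
      using e(1) by (simp add: \<beta>_def smooth_step_values dot_square_norm field_simps)
  qed
  have \<eta>_0: "\<eta> q = 0" if "q \<notin> K" for q
    using that \<beta>_0[of "coord M p q"] unfolding \<eta>_def K_def by (metis cinv_coord imageI)
  have \<eta>_1: "\<forall>\<^sub>F q in nhds p. \<eta> q = 1"
  proof -
    have "\<forall>\<^sub>F x in nhds c. x \<in> ball c e" using e(1) by (intro eventually_nhds_in_open) auto
    then have "\<forall>\<^sub>F q in nhds p. coord M p q \<in> ball c e"
      unfolding c_def by (intro eventually_from_chart) auto
    moreover have "\<forall>\<^sub>F q in nhds p. q \<in> cdom M p" by (rule eventually_in_cdom) simp
    ultimately show ?thesis
    proof eventually_elim
      case (elim q)
      have "(norm (coord M p q - c))\<^sup>2 \<le> e\<^sup>2"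
        using elim(1) by (intro power_mono) (auto simp: dist_norm norm_minus_commute)
      then show ?case
        using elim(2) e(1) by (simp add: \<eta>_def \<beta>_def smooth_step_values dot_square_norm field_simps)
    qed
  qed
  have "smooth_fun_near \<eta> q" for q
  proof (cases "q \<in> cdom M p")
    case True
    have "smooth_near (\<lambda>x. \<eta> (cinv M p x)) (coord M p q)"
      by (rule smooth_near_cong[OF _ \<beta>_smooth])
         (use eventually_in_chart[OF True, of "\<lambda>_. True"] in \<open>auto simp: \<eta>_def elim!: eventually_mono\<close>)
    then show ?thesis using smooth_fun_near_chart[OF True] by simp
  next
    case False
    then have "q \<in> - K" "open (- K)" using K_cdom \<open>closed K\<close> by auto
    then have "\<forall>\<^sub>F r in nhds q. 0 = \<eta> r"
      by (auto simp: \<eta>_0 eventually_nhds intro!: exI[of _ "- K"])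
    then show ?thesis by (rule smooth_fun_near_cong) simp
  qed
  then show ?thesis
    using \<eta>_0 \<eta>_1 K_cdom \<open>closed K\<close> by (intro that[of \<eta> K]) (auto simp: smooth_fun_iff)
qed

text \<open>Connections and metrics act on global objects only.  This lemma and its analogue \<open>extend_field\<close> make
  locally defined ones admissible.\<close>

lemma extend_smooth_fun:
  assumes "smooth_fun_near h p"
  obtains h' where "smooth_fun M h'" "\<forall>\<^sub>F q in nhds p. h' q = h q"
proof -
  obtain U where U: "open U" "p \<in> U" "\<forall>q\<in>U. smooth_fun_near h q"
    using smooth_fun_near_eventually[OF assms] by (auto simp: eventually_nhds)
  obtain \<eta> K where \<eta>: "smooth_fun M \<eta>" "\<forall>\<^sub>F q in nhds p. \<eta> q = 1" "closed K" "K \<subseteq> U" "\<And>q. q \<notin> K \<Longrightarrow> \<eta> q = 0"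
    by (rule bump_function[OF U(1,2)]) blast
  have "smooth_fun_near (\<lambda>q. \<eta> q * h q) q" for q
  proof (cases "q \<in> U")
    case True
    then show ?thesis using U \<eta>(1) by (simp add: smooth_fun_near_mult smooth_fun_iff)
  next
    case False
    have "\<forall>\<^sub>F r in nhds q. 0 = \<eta> r * h r"
      using False \<eta>(3-5) by (auto simp: eventually_nhds intro!: exI[of _ "- K"])
    then show ?thesis by (rule smooth_fun_near_cong) simp
  qed
  moreover have "\<forall>\<^sub>F q in nhds p. \<eta> q * h q = h q"
    by (rule eventually_mono[OF \<eta>(2)]) simp
  ultimately show ?thesis
    using that[of "\<lambda>q. \<eta> q * h q"] by (simp add: smooth_fun_iff)
qed

end

lemma smooth_map_ident: "smooth_manifold M \<Longrightarrow> smooth_map M M (\<lambda>p. p)"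
  unfolding smooth_map_def smooth_manifold_def by (simp add: continuous_on_id)

locale manifold_map = M: manifold M + N: manifold N
  for M :: "('m::{t2_space,second_countable_topology}, 'a::euclidean_space, 'y) atlas_scheme"
    and N :: "('n::{t2_space,second_countable_topology}, 'b::euclidean_space, 'z) atlas_scheme" +
  fixes f :: "'m \<Rightarrow> 'n"
  assumes smooth_map: "smooth_map M N f"
begin

lemma isCont_map: "isCont f p"
  using smooth_map by (simp add: smooth_map_def continuous_on_eq_continuous_at)

lemma eventually_map: "\<forall>\<^sub>F q in nhds (f p). P q \<Longrightarrow> \<forall>\<^sub>F q in nhds p. P (f q)"
  using isCont_map[of p] unfolding isCont_def tendsto_at_iff_tendsto_nhds by (simp add: filterlim_iff)

lemma open_vimage_cdom: "open (cdom M p \<inter> f -` cdom N q)"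
proof -
  have "continuous_on UNIV f" using smooth_map by (simp add: smooth_map_def)
  then have "open (f -` cdom N q)" using N.open_cdom by (rule open_vimage[rotated])
  then show ?thesis by auto
qed

lemma smooth_near_map:
  assumes "r \<in> cdom M p" "f r \<in> cdom N q"
  shows "smooth_near (\<lambda>x. coord N q (f (cinv M p x))) (coord M p r)"
proof -
  have "smooth_on (coord M p ` (cdom M p \<inter> f -` cdom N q)) (\<lambda>x. coord N q (f (cinv M p x)))"
    using smooth_map by (simp add: smooth_map_def)
  then show ?thesis
    by (rule smooth_nearI) (use assms open_vimage_cdom in \<open>auto intro: M.open_coord_image_of\<close>)
qed

text \<open>Components in the chart around \<open>q\<close>, as a function on the chart around \<open>p\<close>.\<close>

definition field_comp :: "'m \<Rightarrow> 'n \<Rightarrow> ('m \<Rightarrow> 'b) \<Rightarrow> 'a \<Rightarrow> 'b" where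
  "field_comp p q V = (\<lambda>x. tchange N (f (cinv M p x)) q (f (cinv M p x)) (V (cinv M p x)))"

definition field_near :: "('m \<Rightarrow> 'b) \<Rightarrow> 'm \<Rightarrow> bool" where
  "field_near V p \<longleftrightarrow> smooth_near (field_comp p (f p) V) (coord M p p)"

lemma eventually_both_charts:
  assumes "r \<in> cdom M p" "f r \<in> cdom N q"
  shows "\<forall>\<^sub>F s in nhds r. s \<in> cdom M p \<and> f s \<in> cdom N q"
  using eventually_nhds_in_open[OF open_vimage_cdom[of p q], of r] assms by simp

text \<open>By the cocycle rule for \<open>tchange\<close>, the new components are a derivative of a transition map applied to
  the old ones.\<close>

lemma smooth_near_field_comp_change:
  assumes "r \<in> cdom M p" "f r \<in> cdom N q" "r \<in> cdom M p'" "f r \<in> cdom N q'"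
    "smooth_near (field_comp p q V) (coord M p r)"
  shows "smooth_near (field_comp p' q' V) (coord M p' r)"
proof -
  let ?g = "\<lambda>x. frechet_derivative (\<lambda>y. coord N q' (cinv N q y)) (at (coord N q (f (cinv M p' x))))
      (field_comp p q V (coord M p (cinv M p' x)))"
  have "smooth_near ?g (coord M p' r)"
  proof (rule smooth_near_derivative_apply)
    show "smooth_near (\<lambda>x. coord N q (f (cinv M p' x))) (coord M p' r)"
      by (rule smooth_near_map[OF assms(3,2)])
    show "smooth_near (\<lambda>y. coord N q' (cinv N q y)) (coord N q (f (cinv M p' (coord M p' r))))"
      using N.smooth_near_transition[OF assms(2,4)] assms(3) by simp
    have "smooth_near (field_comp p q V) (coord M p (cinv M p' (coord M p' r)))"
      using assms(3,5) by simp
    then show "smooth_near (\<lambda>x. field_comp p q V (coord M p (cinv M p' x))) (coord M p' r)"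
      by (rule smooth_near_compose[OF M.smooth_near_transition[OF assms(3,1)]])
  qed
  moreover have "\<forall>\<^sub>F x in nhds (coord M p' r). ?g x = field_comp p' q' V x"
    using M.eventually_in_chart[OF assms(3) eventually_conj[OF eventually_both_charts[OF assms(1,2)]
          eventually_both_charts[OF assms(3,4)]]]
  proof eventually_elim
    case (elim x)
    then show ?case
      using N.tchange_tchange[of "f (cinv M p' x)" "f (cinv M p' x)" q q' "V (cinv M p' x)"]
      by (simp add: field_comp_def tchange_def)
  qed
  ultimately show ?thesis by (rule smooth_near_cong[rotated])
qed

lemma field_near_chart:
  "r \<in> cdom M p \<Longrightarrow> f r \<in> cdom N q \<Longrightarrow> field_near V r \<longleftrightarrow> smooth_near (field_comp p q V) (coord M p r)"
  unfolding field_near_def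
  using smooth_near_field_comp_change[of r r "f r" p q V] smooth_near_field_comp_change[of r p q r "f r" V]
  by auto

lemma field_along_iff: "field_along M N f V \<longleftrightarrow> (\<forall>p. field_near V p)"
proof -
  have "field_along M N f V \<longleftrightarrow> (\<forall>p q. \<forall>r\<in>cdom M p \<inter> f -` cdom N q. smooth_near (field_comp p q V) (coord M p r))"
    using open_vimage_cdom
    by (simp add: field_along_def smooth_on_iff_smooth_near M.open_coord_image_of field_comp_def Let_def)
  also have "\<dots> \<longleftrightarrow> (\<forall>p q. \<forall>r\<in>cdom M p \<inter> f -` cdom N q. field_near V r)"
    by (auto simp: field_near_chart[symmetric])
  also have "\<dots> \<longleftrightarrow> (\<forall>p. field_near V p)"
    using M.mem_cdom N.mem_cdom by blast
  finally show ?thesis .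
qed

lemma field_near_eventually:
  assumes "field_near V p" shows "\<forall>\<^sub>F q in nhds p. field_near V q"
  using eventually_conj[OF eventually_both_charts[of p p "f p"] M.eventually_from_chart[of p p,
        OF M.mem_cdom smooth_near_eventually[OF assms[unfolded field_near_def]]]]
  by (auto simp: field_near_chart elim!: eventually_mono)

lemma field_near_cong:
  assumes "\<forall>\<^sub>F q in nhds p. V q = W q" "field_near V p"
  shows "field_near W p"
  using assms(2) M.eventually_in_chart[OF M.mem_cdom assms(1)] unfolding field_near_def
  by (elim smooth_near_cong[rotated]) (auto simp: field_comp_def elim!: eventually_mono)

lemma eventually_in_field_chart:
  "\<forall>\<^sub>F x in nhds (coord M p p). f (cinv M p x) \<in> cdom N (f p)"
  using M.eventually_in_chart[OF M.mem_cdom eventually_both_charts[OF M.mem_cdom N.mem_cdom], of p]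
  by (auto elim: eventually_mono)

lemma field_near_zero: "field_near (\<lambda>_. 0) p"
proof -
  have "\<forall>\<^sub>F x in nhds (coord M p p). 0 = field_comp p (f p) (\<lambda>_. 0) x"
    by (rule eventually_mono[OF eventually_in_field_chart]) (simp add: field_comp_def linear_0[OF N.linear_tchange])
  then show ?thesis
    unfolding field_near_def by (rule smooth_near_cong) simp
qed

lemma field_near_add:
  assumes "field_near V p" "field_near W p" shows "field_near (\<lambda>q. V q + W q) p"
proof -
  have "\<forall>\<^sub>F x in nhds (coord M p p). field_comp p (f p) V x + field_comp p (f p) W x =
      field_comp p (f p) (\<lambda>q. V q + W q) x"
    by (rule eventually_mono[OF eventually_in_field_chart]) (simp add: field_comp_def linear_add[OF N.linear_tchange])
  then show ?thesis
    using assms unfolding field_near_def by (auto intro: smooth_near_cong smooth_near_add)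
qed

lemma field_near_scaleR:
  assumes "M.smooth_fun_near h p" "field_near V p" shows "field_near (\<lambda>q. h q *\<^sub>R V q) p"
proof -
  have "\<forall>\<^sub>F x in nhds (coord M p p). h (cinv M p x) *\<^sub>R field_comp p (f p) V x =
      field_comp p (f p) (\<lambda>q. h q *\<^sub>R V q) x"
    by (rule eventually_mono[OF eventually_in_field_chart]) (simp add: field_comp_def linear_cmul[OF N.linear_tchange])
  then show ?thesis
    using assms unfolding field_near_def M.smooth_fun_near_def
    by (auto intro: smooth_near_cong smooth_near_scaleR)
qed

lemma field_along_zero: "field_along M N f (\<lambda>_. 0)"
  by (simp add: field_along_iff field_near_zero)

lemma field_along_add: "field_along M N f V \<Longrightarrow> field_along M N f W \<Longrightarrow> field_along M N f (\<lambda>q. V q + W q)"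
  by (simp add: field_along_iff field_near_add)

lemma field_along_scaleR: "smooth_fun M h \<Longrightarrow> field_along M N f V \<Longrightarrow> field_along M N f (\<lambda>q. h q *\<^sub>R V q)"
  by (simp add: field_along_iff field_near_scaleR M.smooth_fun_iff)

lemma field_along_cmult: "field_along M N f V \<Longrightarrow> field_along M N f (\<lambda>q. c *\<^sub>R V q)"
  by (rule field_along_scaleR[OF M.smooth_fun_const])

lemma field_along_diff: "field_along M N f V \<Longrightarrow> field_along M N f W \<Longrightarrow> field_along M N f (\<lambda>q. V q - W q)"
  using field_along_add[OF _ field_along_cmult[of W "-1"]] by simp

lemma field_along_sum:
  "(\<And>i. i \<in> I \<Longrightarrow> field_along M N f (V i)) \<Longrightarrow> field_along M N f (\<lambda>q. \<Sum>i\<in>I. V i q)"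
  by (induction I rule: infinite_finite_induct) (simp_all add: field_along_zero field_along_add)

lemma extend_field:
  assumes "field_near V p"
  obtains V' where "field_along M N f V'" "\<forall>\<^sub>F q in nhds p. V' q = V q"
proof -
  obtain U where U: "open U" "p \<in> U" "\<forall>q\<in>U. field_near V q"
    using field_near_eventually[OF assms] by (auto simp: eventually_nhds)
  obtain \<eta> K where \<eta>: "smooth_fun M \<eta>" "\<forall>\<^sub>F q in nhds p. \<eta> q = 1" "closed K" "K \<subseteq> U" "\<And>q. q \<notin> K \<Longrightarrow> \<eta> q = 0"
    by (rule M.bump_function[OF U(1,2)]) blast
  have "field_near (\<lambda>q. \<eta> q *\<^sub>R V q) q" for q
  proof (cases "q \<in> U")
    case True
    then show ?thesis using U \<eta>(1) by (simp add: field_near_scaleR M.smooth_fun_iff)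
  next
    case False
    have "\<forall>\<^sub>F r in nhds q. 0 = \<eta> r *\<^sub>R V r"
      using False \<eta>(3-5) by (auto simp: eventually_nhds intro!: exI[of _ "- K"])
    then show ?thesis by (rule field_near_cong) (rule field_near_zero)
  qed
  moreover have "\<forall>\<^sub>F q in nhds p. \<eta> q *\<^sub>R V q = V q"
    by (rule eventually_mono[OF \<eta>(2)]) simp
  ultimately show ?thesis
    using that[of "\<lambda>q. \<eta> q *\<^sub>R V q"] by (simp add: field_along_iff)
qed

end

text \<open>Vector fields being fields along the identity map, everything proved for the latter applies to them.\<close>

sublocale manifold \<subseteq> ident: manifold_map M M "\<lambda>p. p"
  by unfold_locales (rule smooth_map_ident[OF smooth_manifold])


section \<open>Derivatives of functions and of maps\<close>

context manifold
begin

lemma vector_field_iff: "vector_field M X \<longleftrightarrow> (\<forall>p. ident.field_near X p)"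
  by (simp add: vector_field_def ident.field_along_iff)

lemma dderiv_chart:
  assumes "smooth_fun_near h r" "r \<in> cdom M p"
  shows "dderiv M h r u = frechet_derivative (\<lambda>x. h (cinv M p x)) (at (coord M p r)) (tchange M r p r u)"
proof -
  have eq: "frechet_derivative (\<lambda>x. h (cinv M r x)) (at (coord M r r)) =
      frechet_derivative (\<lambda>x. h (cinv M p (coord M p (cinv M r x)))) (at (coord M r r))"
    using eventually_in_chart[OF mem_cdom eventually_in_cdom[OF assms(2)]] assms(1)
    by (intro frechet_derivative_cong_near) (auto simp: smooth_fun_near_def elim!: eventually_mono)
  show ?thesis
    using frechet_derivative_chain[of "\<lambda>x. coord M p (cinv M r x)" "coord M r r" "\<lambda>x. h (cinv M p x)" u]
      smooth_near_transition[of r r p] assms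
    by (simp add: smooth_fun_near_chart tchange_def dderiv_def eq)
qed

lemma linear_dderiv: "smooth_fun_near h p \<Longrightarrow> linear (dderiv M h p)"
  unfolding dderiv_def[abs_def] smooth_fun_near_def by (rule smooth_near_linear)

lemma dderiv_cong:
  assumes "\<forall>\<^sub>F q in nhds p. h q = k q" "smooth_fun_near h p"
  shows "dderiv M h p u = dderiv M k p u"
proof -
  have "frechet_derivative (\<lambda>x. h (cinv M p x)) (at (coord M p p)) =
      frechet_derivative (\<lambda>x. k (cinv M p x)) (at (coord M p p))"
    using eventually_in_chart[OF mem_cdom assms(1)] assms(2)
    by (intro frechet_derivative_cong_near) (auto simp: smooth_fun_near_def elim!: eventually_mono)
  then show ?thesis by (simp add: dderiv_def)
qed

lemma dderiv_const [simp]: "dderiv M (\<lambda>_. c) p u = 0"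
  by (simp add: dderiv_def)

lemma dderiv_add:
  assumes "smooth_fun_near h p" "smooth_fun_near k p"
  shows "dderiv M (\<lambda>q. h q + k q) p u = dderiv M h p u + dderiv M k p u"
  using fun_cong[OF frechet_derivative_at[OF has_derivative_add[OF
        assms[unfolded smooth_fun_near_def, THEN smooth_near_has_derivative]]], of u]
  by (simp add: dderiv_def)

lemma dderiv_mult:
  assumes "smooth_fun_near h p" "smooth_fun_near k p"
  shows "dderiv M (\<lambda>q. h q * k q) p u = dderiv M h p u * k p + h p * dderiv M k p u"
  using fun_cong[OF frechet_derivative_at[OF has_derivative_mult[OF
        assms[unfolded smooth_fun_near_def, THEN smooth_near_has_derivative]]], of u]
  by (simp add: dderiv_def)

text \<open>Derivatives of the coordinate functions, extended to the whole manifold, detect every component.\<close>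

lemma dderiv_separates:
  assumes "\<And>h. smooth_fun M h \<Longrightarrow> dderiv M h p w = 0"
  shows "w = 0"
proof -
  have "w \<bullet> b = 0" for b
  proof -
    have *: "\<forall>\<^sub>F x in nhds (coord M p p). x \<bullet> b = coord M p (cinv M p x) \<bullet> b"
      using eventually_in_chart[of p p "\<lambda>_. True"] by (auto elim!: eventually_mono)
    have lin: "smooth_near (\<lambda>x. x \<bullet> b) (coord M p p)"
      by (intro smooth_near_inner) auto
    then have sm: "smooth_fun_near (\<lambda>q. coord M p q \<bullet> b) p"
      unfolding smooth_fun_near_def by (rule smooth_near_cong[OF *])
    obtain h where h: "smooth_fun M h" "\<forall>\<^sub>F q in nhds p. h q = coord M p q \<bullet> b"
      by (rule extend_smooth_fun[OF sm])
    have "frechet_derivative (\<lambda>x. x \<bullet> b) (at (coord M p p)) = (\<lambda>v. v \<bullet> b)"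
      by (intro frechet_derivative_at[symmetric] derivative_eq_intros) auto
    then have "dderiv M (\<lambda>q. coord M p q \<bullet> b) p w = w \<bullet> b"
      using frechet_derivative_cong_near[OF * lin] by (simp add: dderiv_def)
    then show ?thesis
      using dderiv_cong[OF h(2) smooth_fun_nearD[OF h(1)]] assms[OF h(1)] by simp
  qed
  from this[of w] show ?thesis by simp
qed

lemma field_near_coordinate: "ident.field_near (\<lambda>q. tchange M p q q b) p"
proof -
  have "\<forall>\<^sub>F x in nhds (coord M p p). b = ident.field_comp p p (\<lambda>q. tchange M p q q b) x"
    using eventually_in_chart[of p p, OF mem_cdom eventually_in_cdom[of p p, OF mem_cdom]]
    by (auto simp: ident.field_comp_def tchange_tchange elim!: eventually_mono)
  then show ?thesis
    unfolding ident.field_near_def by (rule smooth_near_cong) simp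
qed

lemma coordinate_field:
  obtains W where "vector_field M W" "\<forall>\<^sub>F q in nhds p. W q = tchange M p q q b"
  using ident.extend_field[OF field_near_coordinate] unfolding vector_field_def by blast

lemma extend_vector:
  obtains X where "vector_field M X" "X p = u"
proof -
  obtain X where X: "vector_field M X" "\<forall>\<^sub>F q in nhds p. X q = tchange M p q q u"
    by (rule coordinate_field)
  then show ?thesis using that[OF X(1)] eventually_nhds_x_imp_x[OF X(2)] by simp
qed

end

context manifold_map
begin

lemma tmap_chart:
  assumes "r \<in> cdom M p" "f r \<in> cdom N q"
  shows "tchange N (f r) q (f r) (tmap M N f r u) =
    frechet_derivative (\<lambda>x. coord N q (f (cinv M p x))) (at (coord M p r)) (tchange M r p r u)"
proof -
  let ?F = "\<lambda>s t x. coord N t (f (cinv M s x))"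
  have "tchange N (f r) q (f r) (tmap M N f r u) =
      frechet_derivative (\<lambda>x. coord N q (cinv N (f r) (?F r (f r) x))) (at (coord M r r)) u"
    using frechet_derivative_chain[OF smooth_near_map[of r r "f r"], of "\<lambda>y. coord N q (cinv N (f r) y)" u]
      N.smooth_near_transition[of "f r" "f r" q] assms
    by (simp add: tmap_def tchange_def)
  also have "frechet_derivative (\<lambda>x. coord N q (cinv N (f r) (?F r (f r) x))) (at (coord M r r)) =
      frechet_derivative (\<lambda>x. ?F p q (coord M p (cinv M r x))) (at (coord M r r))"
  proof (rule frechet_derivative_cong_near)
    show "\<forall>\<^sub>F x in nhds (coord M r r). coord N q (cinv N (f r) (?F r (f r) x)) = ?F p q (coord M p (cinv M r x))"
      using M.eventually_in_chart[OF M.mem_cdom eventually_conj[OF M.eventually_in_cdom[OF assms(1)]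
            eventually_both_charts[of r r "f r"]]]
      by (auto elim!: eventually_mono)
    have "smooth_near (\<lambda>y. coord N q (cinv N (f r) y)) (coord N (f r) (f (cinv M r (coord M r r))))"
      using N.smooth_near_transition[of "f r" "f r" q] assms(2) by simp
    then show "smooth_near (\<lambda>x. coord N q (cinv N (f r) (?F r (f r) x))) (coord M r r)"
      by (rule smooth_near_compose[OF smooth_near_map[OF M.mem_cdom N.mem_cdom]])
  qed
  also have "\<dots> u = frechet_derivative (?F p q) (at (coord M p r)) (tchange M r p r u)"
    using frechet_derivative_chain[OF M.smooth_near_transition[of r r p], of "?F p q" u]
      smooth_near_map[OF assms] assms by (simp add: tchange_def)
  finally show ?thesis .
qed

lemma linear_tmap: "linear (tmap M N f p)"
  unfolding tmap_def using smooth_near_linear[OF smooth_near_map] by simp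

lemma smooth_fun_compose:
  assumes "smooth_fun N h"
  shows "smooth_fun M (\<lambda>q. h (f q))"
  unfolding M.smooth_fun_iff
proof
  fix p
  have "smooth_near (\<lambda>y. h (cinv N (f p) y)) (coord N (f p) (f (cinv M p (coord M p p))))"
    using N.smooth_fun_nearD[OF assms, of "f p"] by (simp add: N.smooth_fun_near_def)
  then have "smooth_near (\<lambda>x. h (cinv N (f p) (coord N (f p) (f (cinv M p x))))) (coord M p p)"
    by (rule smooth_near_compose[OF smooth_near_map[OF M.mem_cdom N.mem_cdom]])
  then show "M.smooth_fun_near (\<lambda>q. h (f q)) p"
    unfolding M.smooth_fun_near_def
    by (rule smooth_near_cong[rotated]) (auto intro: eventually_mono[OF eventually_in_field_chart])
qed

lemma dderiv_compose:
  assumes "smooth_fun N h"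
  shows "dderiv M (\<lambda>q. h (f q)) p u = dderiv N h (f p) (tmap M N f p u)"
proof -
  let ?h = "\<lambda>y. h (cinv N (f p) y)" and ?F = "\<lambda>x. coord N (f p) (f (cinv M p x))"
  have h: "smooth_near ?h (?F (coord M p p))"
    using N.smooth_fun_nearD[OF assms, of "f p"] by (simp add: N.smooth_fun_near_def)
  have F: "smooth_near ?F (coord M p p)"
    by (rule smooth_near_map) auto
  have "frechet_derivative (\<lambda>x. ?h (?F x)) (at (coord M p p)) =
      frechet_derivative (\<lambda>x. h (f (cinv M p x))) (at (coord M p p))"
    by (intro frechet_derivative_cong_near smooth_near_compose[OF F h]
        eventually_mono[OF eventually_in_field_chart]) simp
  then show ?thesis
    using frechet_derivative_chain[OF F h, of u] by (simp add: dderiv_def tmap_def)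
qed

lemma smooth_fun_dderiv_along:
  assumes "smooth_fun N h" "field_along M N f V"
  shows "smooth_fun M (\<lambda>q. dderiv N h (f q) (V q))"
  unfolding M.smooth_fun_iff
proof
  fix p
  have "smooth_near (\<lambda>x. frechet_derivative (\<lambda>y. h (cinv N (f p) y)) (at (coord N (f p) (f (cinv M p x))))
      (field_comp p (f p) V x)) (coord M p p)"
    using assms N.smooth_fun_nearD[OF assms(1), of "f p"]
    by (intro smooth_near_derivative_apply smooth_near_map)
       (auto simp: N.smooth_fun_near_def field_along_iff field_near_def)
  then show "M.smooth_fun_near (\<lambda>q. dderiv N h (f q) (V q)) p"
    unfolding M.smooth_fun_near_def
    by (rule smooth_near_cong[rotated])
       (auto intro!: eventually_mono[OF eventually_in_field_chart]
          simp: N.dderiv_chart[OF N.smooth_fun_nearD[OF assms(1)]] field_comp_def)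
qed

lemma field_along_tmap:
  assumes "vector_field M Y"
  shows "field_along M N f (\<lambda>q. tmap M N f q (Y q))"
  unfolding field_along_iff
proof
  fix p
  have "smooth_near (\<lambda>x. frechet_derivative (\<lambda>y. coord N (f p) (f (cinv M p y))) (at x)
      (M.ident.field_comp p p Y x)) (coord M p p)"
    using assms
    by (intro smooth_near_derivative_apply[of "\<lambda>x. x"] smooth_near_map)
       (auto simp: M.vector_field_iff M.ident.field_near_def)
  moreover have "\<forall>\<^sub>F x in nhds (coord M p p). frechet_derivative (\<lambda>y. coord N (f p) (f (cinv M p y))) (at x)
      (M.ident.field_comp p p Y x) = field_comp p (f p) (\<lambda>q. tmap M N f q (Y q)) x"
    using M.eventually_in_chart[OF M.mem_cdom eventually_both_charts[OF M.mem_cdom N.mem_cdom]]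
  proof eventually_elim
    case (elim x)
    then show ?case
      using tmap_chart[of "cinv M p x" p "f p" "Y (cinv M p x)"]
      by (simp add: field_comp_def M.ident.field_comp_def)
  qed
  ultimately show "field_near (\<lambda>q. tmap M N f q (Y q)) p"
    unfolding field_near_def by (rule smooth_near_cong[rotated])
qed

lemma field_along_compose:
  assumes "vector_field N W"
  shows "field_along M N f (\<lambda>q. W (f q))"
  unfolding field_along_iff
proof
  fix p
  have "smooth_near (N.ident.field_comp (f p) (f p) W) (coord N (f p) (f (cinv M p (coord M p p))))"
    using assms by (simp add: N.vector_field_iff N.ident.field_near_def)
  then have "smooth_near (\<lambda>x. N.ident.field_comp (f p) (f p) W (coord N (f p) (f (cinv M p x)))) (coord M p p)"
    by (rule smooth_near_compose[OF smooth_near_map[OF M.mem_cdom N.mem_cdom]])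
  then show "field_near (\<lambda>q. W (f q)) p"
    unfolding field_near_def
    by (rule smooth_near_cong[rotated])
       (auto intro!: eventually_mono[OF eventually_in_field_chart] simp: field_comp_def N.ident.field_comp_def)
qed

section \<open>Induction over fields along a map\<close>

text \<open>Near each point, a field along \<open>f\<close> is a combination of the coordinate fields of \<open>N\<close>, with smooth
  coefficients.  A property of the behaviour of a field near \<open>p\<close> thus only has to be checked for
  fields \<open>W \<circ> f\<close> and to be stable under sums and multiplication by functions.  The metricity of
  the pullback connection, its torsion and its compatibility with \<open>F\<close> are all reduced to the connection
  of \<open>N\<close> in this way.\<close>

lemma field_along_induct [consumes 1, case_names compose add scale cong]:
  assumes V: "field_along M N f V"
    and compose: "\<And>W. vector_field N W \<Longrightarrow> P (\<lambda>q. W (f q))"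
    and add: "\<And>V W. field_along M N f V \<Longrightarrow> field_along M N f W \<Longrightarrow> P V \<Longrightarrow> P W \<Longrightarrow> P (\<lambda>q. V q + W q)"
    and scale: "\<And>h V. smooth_fun M h \<Longrightarrow> field_along M N f V \<Longrightarrow> P V \<Longrightarrow> P (\<lambda>q. h q *\<^sub>R V q)"
    and cong: "\<And>V W. field_along M N f V \<Longrightarrow> field_along M N f W \<Longrightarrow> P V \<Longrightarrow>
      \<forall>\<^sub>F q in nhds p. V q = W q \<Longrightarrow> P W"
  shows "P V"
proof -
  define v where "v b q = tchange N (f q) (f p) (f q) (V q) \<bullet> b" for b q
  have "M.smooth_fun_near (v b) p" for b
  proof -
    have "smooth_near (\<lambda>x. field_comp p (f p) V x \<bullet> b) (coord M p p)"
      using V by (intro smooth_near_inner) (auto simp: field_along_iff field_near_def)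
    then show ?thesis by (simp add: M.smooth_fun_near_def v_def field_comp_def)
  qed
  then have "\<exists>h. smooth_fun M h \<and> (\<forall>\<^sub>F q in nhds p. h q = v b q)" for b
    by (metis M.extend_smooth_fun)
  then obtain h where h: "\<And>b. smooth_fun M (h b)" "\<And>b. \<forall>\<^sub>F q in nhds p. h b q = v b q"
    by metis
  have "\<exists>W. vector_field N W \<and> (\<forall>\<^sub>F q in nhds (f p). W q = tchange N (f p) q q b)" for b
    by (metis N.coordinate_field)
  then obtain W where W: "\<And>b. vector_field N (W b)" "\<And>b. \<forall>\<^sub>F q in nhds (f p). W b q = tchange N (f p) q q b"
    by metis
  have field: "field_along M N f (\<lambda>q. h b q *\<^sub>R W b (f q))" for b
    by (intro field_along_scaleR h field_along_compose W)
  have zero: "P (\<lambda>q. 0)"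
    using scale[OF M.smooth_fun_const[of 0] field_along_compose[OF W(1)] compose[OF W(1)]] by simp
  have "P (\<lambda>q. \<Sum>b\<in>B. h b q *\<^sub>R W b (f q))" for B :: "'b set"
    by (induction B rule: infinite_finite_induct)
       (auto simp: zero intro!: add scale h field_along_compose W compose field_along_sum field)
  then have *: "P (\<lambda>q. \<Sum>b\<in>Basis. h b q *\<^sub>R W b (f q))" .
  have "\<forall>\<^sub>F q in nhds p. \<forall>b\<in>Basis. h b q = v b q \<and> W b (f q) = tchange N (f p) (f q) (f q) b"
    by (intro eventually_ball_finite ballI eventually_conj h eventually_map[OF W(2)]) auto
  then have "\<forall>\<^sub>F q in nhds p. (\<Sum>b\<in>Basis. h b q *\<^sub>R W b (f q)) = V q"
    using eventually_both_charts[OF M.mem_cdom N.mem_cdom, of p]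
  proof eventually_elim
    case (elim q)
    let ?w = "tchange N (f q) (f p) (f q) (V q)"
    have "V q = tchange N (f p) (f q) (f q) ?w"
      using elim(2) by (simp add: N.tchange_tchange)
    also have "\<dots> = (\<Sum>b\<in>Basis. (?w \<bullet> b) *\<^sub>R tchange N (f p) (f q) (f q) b)"
      using elim(2) by (intro linear_basis_expansion N.linear_tchange) auto
    also have "\<dots> = (\<Sum>b\<in>Basis. h b q *\<^sub>R W b (f q))"
      using elim(1) by (simp add: v_def)
    finally show ?case by simp
  qed
  then show ?thesis by (rule cong[OF field_along_sum[OF field] V *])
qed

end


section \<open>Connections\<close>

lemmas (in manifold) vector_field_zero = ident.field_along_zero[folded vector_field_def]
  and vector_field_add = ident.field_along_add[folded vector_field_def]
  and vector_field_scaleR = ident.field_along_scaleR[folded vector_field_def]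
  and vector_field_cmult = ident.field_along_cmult[folded vector_field_def]
  and vector_field_diff = ident.field_along_diff[folded vector_field_def]
  and vector_field_sum = ident.field_along_sum[folded vector_field_def]

context manifold
begin

lemma bump_times_eq_of_agree_near:
  assumes "\<forall>\<^sub>F q in nhds p. V q = (W q :: 'v::real_vector)"
  obtains \<eta> where "smooth_fun M \<eta>" "\<eta> p = 1" "(\<lambda>q. \<eta> q *\<^sub>R V q) = (\<lambda>q. \<eta> q *\<^sub>R W q)"
proof -
  obtain U where U: "open U" "p \<in> U" "\<forall>q\<in>U. V q = W q"
    using assms by (auto simp: eventually_nhds)
  obtain \<eta> K where \<eta>: "smooth_fun M \<eta>" "\<forall>\<^sub>F q in nhds p. \<eta> q = 1" "K \<subseteq> U" "\<And>q. q \<notin> K \<Longrightarrow> \<eta> q = 0"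
    by (rule bump_function[OF U(1,2)]) blast
  have "\<eta> q *\<^sub>R V q = \<eta> q *\<^sub>R W q" for q
    using U(3) \<eta>(3,4) by (cases "q \<in> K") auto
  then show ?thesis using that \<eta>(1) eventually_nhds_x_imp_x[OF \<eta>(2)] by blast
qed

end

locale connection = manifold_map M N f
  for M :: "('m::{t2_space,second_countable_topology}, 'a::euclidean_space, 'y) atlas_scheme"
    and N :: "('n::{t2_space,second_countable_topology}, 'b::euclidean_space, 'z) atlas_scheme"
    and f +
  fixes D :: "('m \<Rightarrow> 'a) \<Rightarrow> ('m \<Rightarrow> 'b) \<Rightarrow> 'm \<Rightarrow> 'b"
  assumes connection: "connection_along M N f D"
begin

lemma D_field: "vector_field M X \<Longrightarrow> field_along M N f V \<Longrightarrow> field_along M N f (D X V)"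
  and D_add_left: "vector_field M X \<Longrightarrow> vector_field M Y \<Longrightarrow> field_along M N f V \<Longrightarrow>
    D (\<lambda>q. X q + Y q) V p = D X V p + D Y V p"
  and D_scale_left: "smooth_fun M h \<Longrightarrow> vector_field M X \<Longrightarrow> field_along M N f V \<Longrightarrow>
    D (\<lambda>q. h q *\<^sub>R X q) V p = h p *\<^sub>R D X V p"
  and D_add: "vector_field M X \<Longrightarrow> field_along M N f V \<Longrightarrow> field_along M N f W \<Longrightarrow>
    D X (\<lambda>q. V q + W q) p = D X V p + D X W p"
  and D_scale: "smooth_fun M h \<Longrightarrow> vector_field M X \<Longrightarrow> field_along M N f V \<Longrightarrow>
    D X (\<lambda>q. h q *\<^sub>R V q) p = dderiv M h p (X p) *\<^sub>R V p + h p *\<^sub>R D X V p"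
  using connection unfolding connection_along_def by blast+

lemma D_cmult: "vector_field M X \<Longrightarrow> field_along M N f V \<Longrightarrow> D X (\<lambda>q. c *\<^sub>R V q) p = c *\<^sub>R D X V p"
  using D_scale[OF M.smooth_fun_const] by simp

text \<open>Both slots are local: a bump function turns fields that agree near \<open>p\<close> into equal fields.\<close>

lemma D_cong:
  assumes "vector_field M X" "field_along M N f V" "field_along M N f W" "\<forall>\<^sub>F q in nhds p. V q = W q"
  shows "D X V p = D X W p"
proof -
  obtain \<eta> where "smooth_fun M \<eta>" "\<eta> p = 1" "(\<lambda>q. \<eta> q *\<^sub>R V q) = (\<lambda>q. \<eta> q *\<^sub>R W q)"
    by (rule M.bump_times_eq_of_agree_near[OF assms(4)])
  then show ?thesis
    using D_scale[of \<eta> X V p] D_scale[of \<eta> X W p] assms(1-3) eventually_nhds_x_imp_x[OF assms(4)] by simp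
qed

lemma D_cong_left:
  assumes "vector_field M X" "vector_field M Y" "field_along M N f V" "\<forall>\<^sub>F q in nhds p. X q = Y q"
  shows "D X V p = D Y V p"
proof -
  obtain \<eta> where "smooth_fun M \<eta>" "\<eta> p = 1" "(\<lambda>q. \<eta> q *\<^sub>R X q) = (\<lambda>q. \<eta> q *\<^sub>R Y q)"
    by (rule M.bump_times_eq_of_agree_near[OF assms(4)])
  then show ?thesis
    using D_scale_left[of \<eta> X V p] D_scale_left[of \<eta> Y V p] assms(1-3) by simp
qed

lemma D_sum_left:
  assumes "\<And>i. i \<in> I \<Longrightarrow> smooth_fun M (h i)" "\<And>i. i \<in> I \<Longrightarrow> vector_field M (X i)" "field_along M N f V"
  shows "D (\<lambda>q. \<Sum>i\<in>I. h i q *\<^sub>R X i q) V p = (\<Sum>i\<in>I. h i p *\<^sub>R D (X i) V p)"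
  using assms(1,2)
proof (induction I rule: infinite_finite_induct)
  case (insert j I)
  have 1: "vector_field M (\<lambda>q. h j q *\<^sub>R X j q)"
    by (rule M.vector_field_scaleR) (use insert in auto)
  have 2: "vector_field M (\<lambda>q. \<Sum>i\<in>I. h i q *\<^sub>R X i q)"
    by (intro M.vector_field_sum M.vector_field_scaleR) (use insert in auto)
  show ?case using D_add_left[OF 1 2 assms(3)] insert assms(3) by (simp add: D_scale_left)
qed (use D_scale_left[OF M.smooth_fun_const[of 0] M.vector_field_zero assms(3)] in auto)

end


section \<open>Riemannian manifolds and isometric immersions\<close>

locale riemannian = manifold M
  for M :: "('m::{t2_space,second_countable_topology}, 'a::euclidean_space, 'z) riemannian_scheme" +
  assumes riemannian: "riemannian_manifold M"
begin

lemma bilinear_metric: "bilinear (metric M p)"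
  and metric_sym: "metric M p u v = metric M p v u"
  and metric_pos: "u \<noteq> 0 \<Longrightarrow> metric M p u u > 0"
  and smooth_metric: "vector_field M X \<Longrightarrow> vector_field M Y \<Longrightarrow> smooth_fun M (\<lambda>p. metric M p (X p) (Y p))"
  using riemannian unfolding riemannian_manifold_def riemannian_metric_def by blast+

lemmas metric_simps =
  bilinear_ladd[OF bilinear_metric] bilinear_radd[OF bilinear_metric]
  bilinear_lsub[OF bilinear_metric] bilinear_rsub[OF bilinear_metric]
  bilinear_lmul[OF bilinear_metric] bilinear_rmul[OF bilinear_metric]
  bilinear_lneg[OF bilinear_metric] bilinear_rneg[OF bilinear_metric]
  bilinear_lzero[OF bilinear_metric] bilinear_rzero[OF bilinear_metric]

lemma metric_sum_left: "metric M p (\<Sum>i\<in>I. u i) v = (\<Sum>i\<in>I. metric M p (u i) v)"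
  by (induction I rule: infinite_finite_induct) (simp_all add: metric_simps)

lemma metric_sum_right: "metric M p u (\<Sum>i\<in>I. v i) = (\<Sum>i\<in>I. metric M p u (v i))"
  by (induction I rule: infinite_finite_induct) (simp_all add: metric_simps)

lemma metric_zero_iff: "metric M p u u = 0 \<longleftrightarrow> u = 0"
  using metric_pos[of u p] bilinear_lzero[OF bilinear_metric, of p 0] by force

lemma levi_civita: "levi_civita M (metric M) (conn M)"
  using riemannian by (simp add: riemannian_manifold_def)

lemma torsion_free: "vector_field M X \<Longrightarrow> vector_field M Y \<Longrightarrow> smooth_fun M h \<Longrightarrow>
    dderiv M h p (conn M X Y p - conn M Y X p) =
    dderiv M (\<lambda>q. dderiv M h q (Y q)) p (X p) - dderiv M (\<lambda>q. dderiv M h q (X q)) p (Y p)"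
  and metric_conn: "vector_field M X \<Longrightarrow> vector_field M Y \<Longrightarrow> vector_field M Z \<Longrightarrow>
    dderiv M (\<lambda>q. metric M q (Y q) (Z q)) p (X p) =
    metric M p (conn M X Y p) (Z p) + metric M p (Y p) (conn M X Z p)"
  using levi_civita unfolding levi_civita_def by blast+

end

context riemannian
begin

text \<open>Torsion-freeness of the connection is the symmetry of the Hessians of all functions.  In this form
  it can be transported to fields along a map, which have no Lie bracket.\<close>

definition hessian :: "('m \<Rightarrow> real) \<Rightarrow> ('m \<Rightarrow> 'a) \<Rightarrow> ('m \<Rightarrow> 'a) \<Rightarrow> 'm \<Rightarrow> real" where
  "hessian h X Y p = dderiv M (\<lambda>q. dderiv M h q (Y q)) p (X p) - dderiv M h p (conn M X Y p)"

lemma hessian_sym: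
  assumes "smooth_fun M h" "vector_field M X" "vector_field M Y"
  shows "hessian h X Y p = hessian h Y X p"
  using torsion_free[OF assms(2,3,1), of p]
    linear_diff[OF linear_dderiv[OF smooth_fun_nearD[OF assms(1)]], of p]
  by (simp add: hessian_def)

lemma smooth_fun_dderiv_field:
  "smooth_fun M h \<Longrightarrow> vector_field M X \<Longrightarrow> smooth_fun M (\<lambda>q. dderiv M h q (X q))"
  unfolding vector_field_def by (rule ident.smooth_fun_dderiv_along)

end

sublocale riemannian \<subseteq> conn: connection M M "\<lambda>p. p" "conn M"
  by unfold_locales (use levi_civita in \<open>simp add: levi_civita_def\<close>)

locale riemannian_submanifold = M: riemannian M + N: riemannian N
  for M :: "('m::{t2_space,second_countable_topology}, 'a::euclidean_space, 'y) riemannian_scheme"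
    and N :: "('n::{t2_space,second_countable_topology}, 'b::euclidean_space, 'z) riemannian_scheme" +
  fixes f :: "'m \<Rightarrow> 'n" and D :: "('m \<Rightarrow> 'a) \<Rightarrow> ('m \<Rightarrow> 'b) \<Rightarrow> 'm \<Rightarrow> 'b"
  assumes isometric: "isometric_immersion M N f"
    and pullback: "pullback_connection M N f D"

sublocale riemannian_submanifold \<subseteq> connection M N f D
  by unfold_locales
     (use isometric pullback in \<open>auto simp: isometric_immersion_def pullback_connection_def\<close>)

context riemannian_submanifold
begin

abbreviation push :: "('m \<Rightarrow> 'a) \<Rightarrow> 'm \<Rightarrow> 'b" where
  "push X \<equiv> \<lambda>q. tmap M N f q (X q)"

lemma metric_tmap: "metric N (f p) (tmap M N f p u) (tmap M N f p v) = metric M p u v"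
  using isometric by (simp add: isometric_immersion_def)

lemma D_compose:
  "vector_field M X \<Longrightarrow> vector_field N Z \<Longrightarrow> vector_field N W \<Longrightarrow> Z (f p) = tmap M N f p (X p) \<Longrightarrow>
    D X (\<lambda>q. W (f q)) p = conn N Z W (f p)"
  using pullback unfolding pullback_connection_def by blast

text \<open>The metric is only known to be smooth on pairs of vector fields of \<open>N\<close>; the induction over fields
  along \<open>f\<close> is applied to one argument after the other.\<close>

lemma smooth_metric_along:
  assumes "field_along M N f V" "field_along M N f W"
  shows "smooth_fun M (\<lambda>q. metric N (f q) (V q) (W q))"
proof -
  have step: "M.smooth_fun_near (\<lambda>q. metric N (f q) (V q) (W q)) p"
    if "\<And>W'. vector_field N W' \<Longrightarrow> M.smooth_fun_near (\<lambda>q. metric N (f q) (V q) (W' (f q))) p"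
      "field_along M N f W" for V W p
    using that(2)
  proof (induction rule: field_along_induct[where p = p])
    case (compose W)
    then show ?case by (rule that(1))
  next
    case (add V W)
    then show ?case by (simp add: N.metric_simps M.smooth_fun_near_add)
  next
    case (scale h V)
    then show ?case by (simp add: N.metric_simps M.smooth_fun_near_mult M.smooth_fun_nearD)
  next
    case (cong W W')
    then show ?case by (elim M.smooth_fun_near_cong[rotated]) (auto elim!: eventually_mono)
  qed
  have "M.smooth_fun_near (\<lambda>q. metric N (f q) (V q) (W' (f q))) p" if "vector_field N W'" for p W'
  proof -
    have "M.smooth_fun_near (\<lambda>q. metric N (f q) (W' (f q)) (V' (f q))) p" if "vector_field N V'" for V'
      using smooth_fun_compose[OF N.smooth_metric[OF \<open>vector_field N W'\<close> that]]
      by (rule M.smooth_fun_nearD)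
    then show ?thesis
      using step[of "\<lambda>q. W' (f q)" p V] assms(1) by (simp add: N.metric_sym)
  qed
  then show ?thesis
    using step[of V _ W] assms(2) by (simp add: M.smooth_fun_iff)
qed

text \<open>Again by induction on one argument after the other; the claim being symmetric in \<open>V\<close> and \<open>W\<close>, the
  same step does for both.\<close>

lemma metric_D:
  assumes X: "vector_field M X" and "field_along M N f V" "field_along M N f W"
  shows "dderiv M (\<lambda>q. metric N (f q) (V q) (W q)) p (X p) =
    metric N (f p) (D X V p) (W p) + metric N (f p) (V p) (D X W p)"
proof -
  define C where "C V W \<longleftrightarrow> dderiv M (\<lambda>q. metric N (f q) (V q) (W q)) p (X p) =
    metric N (f p) (D X V p) (W p) + metric N (f p) (V p) (D X W p)" for V W
  have swap: "C V W \<Longrightarrow> C W V" for V W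
    by (simp add: C_def N.metric_sym[of _ "W _"] N.metric_sym[of _ "D X W p"])
  have step: "C V W"
    if V: "field_along M N f V" and base: "\<And>W'. vector_field N W' \<Longrightarrow> C V (\<lambda>q. W' (f q))"
      and "field_along M N f W" for V W
    using that(3)
  proof (induction rule: field_along_induct[where p = p])
    case (compose W)
    then show ?case by (rule base)
  next
    case (add W W')
    then show ?case
      using M.smooth_fun_nearD[OF smooth_metric_along[OF V add.hyps(1)], of p]
        M.smooth_fun_nearD[OF smooth_metric_along[OF V add.hyps(2)], of p]
      by (simp add: C_def N.metric_simps M.dderiv_add D_add[OF X])
  next
    case (scale h W)
    then show ?case
      using M.smooth_fun_nearD[OF smooth_metric_along[OF V scale.hyps(2)], of p]
        M.smooth_fun_nearD[OF scale.hyps(1), of p]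
      by (simp add: C_def N.metric_simps M.dderiv_mult D_scale[OF _ X] algebra_simps)
  next
    case (cong W W')
    have "dderiv M (\<lambda>q. metric N (f q) (V q) (W q)) p (X p) = dderiv M (\<lambda>q. metric N (f q) (V q) (W' q)) p (X p)"
      by (rule M.dderiv_cong[OF _ M.smooth_fun_nearD[OF smooth_metric_along[OF V cong.hyps(1)]]])
         (use cong.hyps(3) in \<open>auto elim: eventually_mono\<close>)
    then show ?case
      using cong D_cong[OF X cong.hyps(1,2,3)] eventually_nhds_x_imp_x[OF cong.hyps(3)]
      by (simp add: C_def)
  qed
  obtain Z where Z: "vector_field N Z" "Z (f p) = tmap M N f p (X p)"
    by (rule N.extend_vector)
  have "C (\<lambda>q. V' (f q)) (\<lambda>q. W' (f q))" if "vector_field N V'" "vector_field N W'" for V' W'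
    using that Z dderiv_compose[OF N.smooth_metric[OF that], of p "X p"]
      N.metric_conn[OF Z(1) that, of "f p"]
    by (simp add: C_def D_compose[OF X Z(1) _ Z(2)])
  then have "C (\<lambda>q. V' (f q)) W" if "vector_field N V'" for V'
    using step[OF field_along_compose[OF that]] assms(3) that by blast
  then have "C W V"
    using step[OF assms(3)] swap assms(2) by blast
  then show ?thesis using swap by (simp add: C_def)
qed

text \<open>The difference \<open>X (dh V) - dh (D\<^sub>X V)\<close> is the Hessian of \<open>h\<close> at \<open>f p\<close>, evaluated at the image of
  \<open>X\<close> and at \<open>V p\<close>.  The extension of \<open>V p\<close> is chosen before \<open>h\<close>, \<open>X\<close> and \<open>Z\<close>, so that the extensions
  obtained for two fields can serve as each other's \<open>Z\<close>.\<close>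

lemma hessian_along:
  assumes "field_along M N f V"
  shows "\<exists>Z'. vector_field N Z' \<and> Z' (f p) = V p \<and>
    (\<forall>h X Z. smooth_fun N h \<longrightarrow> vector_field M X \<longrightarrow> vector_field N Z \<longrightarrow> Z (f p) = tmap M N f p (X p) \<longrightarrow>
      dderiv M (\<lambda>q. dderiv N h (f q) (V q)) p (X p) - dderiv N h (f p) (D X V p) = N.hessian h Z Z' (f p))"
  (is "?P V")
  using assms
proof (induction rule: field_along_induct[where p = p])
  case (compose W)
  show ?case
    by (rule exI[of _ W])
       (use compose in \<open>simp add: N.hessian_def D_compose dderiv_compose[OF N.smooth_fun_dderiv_field, of _ W]\<close>)
next
  case (add V W)
  obtain V' W' where *: "vector_field N V'" "V' (f p) = V p" "vector_field N W'" "W' (f p) = W p"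
    "\<And>h X Z. smooth_fun N h \<Longrightarrow> vector_field M X \<Longrightarrow> vector_field N Z \<Longrightarrow> Z (f p) = tmap M N f p (X p) \<Longrightarrow>
      dderiv M (\<lambda>q. dderiv N h (f q) (V q)) p (X p) - dderiv N h (f p) (D X V p) = N.hessian h Z V' (f p)"
    "\<And>h X Z. smooth_fun N h \<Longrightarrow> vector_field M X \<Longrightarrow> vector_field N Z \<Longrightarrow> Z (f p) = tmap M N f p (X p) \<Longrightarrow>
      dderiv M (\<lambda>q. dderiv N h (f q) (W q)) p (X p) - dderiv N h (f p) (D X W p) = N.hessian h Z W' (f p)"
    using add.IH by blast
  show ?case
  proof (intro exI[of _ "\<lambda>y. V' y + W' y"] conjI allI impI)
    fix h X Z
    assume a: "smooth_fun N h" "vector_field M X" "vector_field N Z" "Z (f p) = tmap M N f p (X p)"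
    have lin: "linear (dderiv N h y)" for y
      by (rule N.linear_dderiv[OF N.smooth_fun_nearD[OF a(1)]])
    have "N.hessian h Z (\<lambda>y. V' y + W' y) (f p) = N.hessian h Z V' (f p) + N.hessian h Z W' (f p)"
      using N.conn.D_add[OF a(3) *(1)[unfolded vector_field_def] *(3)[unfolded vector_field_def]]
        N.smooth_fun_dderiv_field[OF a(1) *(1)] N.smooth_fun_dderiv_field[OF a(1) *(3)]
      by (simp add: N.hessian_def linear_add[OF lin] N.dderiv_add N.smooth_fun_nearD)
    then show "dderiv M (\<lambda>q. dderiv N h (f q) (V q + W q)) p (X p) - dderiv N h (f p) (D X (\<lambda>q. V q + W q) p) =
        N.hessian h Z (\<lambda>y. V' y + W' y) (f p)"
      using *(5,6)[OF a] smooth_fun_dderiv_along[OF a(1) add.hyps(1)] smooth_fun_dderiv_along[OF a(1) add.hyps(2)]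
      by (simp add: linear_add[OF lin] D_add[OF a(2) add.hyps] M.dderiv_add M.smooth_fun_nearD)
  qed (use * in \<open>auto intro: N.vector_field_add\<close>)
next
  case (scale k V)
  obtain V' where *: "vector_field N V'" "V' (f p) = V p"
    "\<And>h X Z. smooth_fun N h \<Longrightarrow> vector_field M X \<Longrightarrow> vector_field N Z \<Longrightarrow> Z (f p) = tmap M N f p (X p) \<Longrightarrow>
      dderiv M (\<lambda>q. dderiv N h (f q) (V q)) p (X p) - dderiv N h (f p) (D X V p) = N.hessian h Z V' (f p)"
    using scale.IH by blast
  show ?case
  proof (intro exI[of _ "\<lambda>y. k p *\<^sub>R V' y"] conjI allI impI)
    fix h X Z
    assume a: "smooth_fun N h" "vector_field M X" "vector_field N Z" "Z (f p) = tmap M N f p (X p)"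
    have lin: "linear (dderiv N h y)" for y
      by (rule N.linear_dderiv[OF N.smooth_fun_nearD[OF a(1)]])
    have "N.hessian h Z (\<lambda>y. k p *\<^sub>R V' y) (f p) = k p * N.hessian h Z V' (f p)"
      using N.conn.D_cmult[OF a(3) *(1)[unfolded vector_field_def]] N.smooth_fun_dderiv_field[OF a(1) *(1)]
      by (simp add: N.hessian_def linear_cmul[OF lin] N.dderiv_mult N.smooth_fun_nearD right_diff_distrib)
    then show "dderiv M (\<lambda>q. dderiv N h (f q) (k q *\<^sub>R V q)) p (X p) - dderiv N h (f p) (D X (\<lambda>q. k q *\<^sub>R V q) p) =
        N.hessian h Z (\<lambda>y. k p *\<^sub>R V' y) (f p)"
      using *(3)[OF a, symmetric] smooth_fun_dderiv_along[OF a(1) scale.hyps(2)] scale.hyps(1)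
      by (simp add: linear_add[OF lin] linear_cmul[OF lin] D_scale[OF scale.hyps(1) a(2) scale.hyps(2)]
          M.dderiv_mult M.smooth_fun_nearD right_diff_distrib)
  qed (use * in \<open>auto intro: N.vector_field_cmult\<close>)
next
  case (cong V W)
  have "dderiv M (\<lambda>q. dderiv N h (f q) (V q)) p (X p) = dderiv M (\<lambda>q. dderiv N h (f q) (W q)) p (X p)"
    if "smooth_fun N h" for h X
    by (rule M.dderiv_cong[OF _ M.smooth_fun_nearD[OF smooth_fun_dderiv_along[OF that cong.hyps(1)]]])
       (use cong.hyps(3) in \<open>auto elim: eventually_mono\<close>)
  then show ?case
    using cong.IH eventually_nhds_x_imp_x[OF cong.hyps(3)] D_cong[OF _ cong.hyps(1,2,3)] by simp
qed

text \<open>Applied to a function \<open>h\<close>, both sides are the commutator of the derivations \<open>X\<close> and \<open>Y\<close> on \<open>h \<circ> f\<close>: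
  the left one because the Hessian of \<open>h\<close> is symmetric, the right one because \<open>\<nabla>\<close> is torsion-free.\<close>

lemma D_push_torsion_free:
  assumes X: "vector_field M X" and Y: "vector_field M Y"
  shows "D X (push Y) p - D Y (push X) p = tmap M N f p (conn M X Y p - conn M Y X p)"
proof -
  obtain ZX where ZX: "vector_field N ZX" "ZX (f p) = tmap M N f p (X p)"
    "\<And>h Y Z. smooth_fun N h \<Longrightarrow> vector_field M Y \<Longrightarrow> vector_field N Z \<Longrightarrow> Z (f p) = tmap M N f p (Y p) \<Longrightarrow>
      dderiv M (\<lambda>q. dderiv N h (f q) (push X q)) p (Y p) - dderiv N h (f p) (D Y (push X) p) = N.hessian h Z ZX (f p)"
    using hessian_along[OF field_along_tmap[OF X], of p] by blast
  obtain ZY where ZY: "vector_field N ZY" "ZY (f p) = tmap M N f p (Y p)"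
    "\<And>h X Z. smooth_fun N h \<Longrightarrow> vector_field M X \<Longrightarrow> vector_field N Z \<Longrightarrow> Z (f p) = tmap M N f p (X p) \<Longrightarrow>
      dderiv M (\<lambda>q. dderiv N h (f q) (push Y q)) p (X p) - dderiv N h (f p) (D X (push Y) p) = N.hessian h Z ZY (f p)"
    using hessian_along[OF field_along_tmap[OF Y], of p] by blast
  let ?T = "D X (push Y) p - D Y (push X) p - tmap M N f p (conn M X Y p - conn M Y X p)"
  have "dderiv N h (f p) ?T = 0" if h: "smooth_fun N h" for h
  proof -
    have lin: "linear (dderiv N h (f p))"
      by (rule N.linear_dderiv[OF N.smooth_fun_nearD[OF h]])
    have hf: "dderiv M (\<lambda>q. h (f q)) q u = dderiv N h (f q) (tmap M N f q u)" for q u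
      by (rule dderiv_compose[OF h])
    have "dderiv N h (f p) (D X (push Y) p) - dderiv N h (f p) (D Y (push X) p) =
        dderiv M (\<lambda>q. dderiv N h (f q) (push Y q)) p (X p) - dderiv M (\<lambda>q. dderiv N h (f q) (push X q)) p (Y p)"
      using ZY(3)[OF h X ZX(1,2)] ZX(3)[OF h Y ZY(1,2)] N.hessian_sym[OF h ZX(1) ZY(1), of "f p"] by simp
    also have "\<dots> = dderiv N h (f p) (tmap M N f p (conn M X Y p - conn M Y X p))"
      using M.torsion_free[OF X Y smooth_fun_compose[OF h], of p] by (simp add: hf)
    finally show ?thesis by (simp add: linear_diff[OF lin])
  qed
  then have "?T = 0" by (rule N.dderiv_separates)
  then show ?thesis by simp
qed

text \<open>The tangential part of the pullback connection is metric and has the same torsion as the Levi-Civita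
  connection of \<open>M\<close>.  So their difference, contracted with the metric, is symmetric in its first two arguments
  and skew in its last two, hence zero.\<close>

lemma gauss_formula:
  assumes "vector_field M X" "vector_field M Y" "vector_field M Z"
  shows "metric N (f p) (D X (push Y) p) (tmap M N f p (Z p)) = metric M p (conn M X Y p) (Z p)"
proof -
  define s where "s X Y Z = metric N (f p) (D X (push Y) p) (tmap M N f p (Z p)) - metric M p (conn M X Y p) (Z p)"
    for X Y Z
  have sym: "s X Y Z = s Y X Z" if "vector_field M X" "vector_field M Y" for X Y Z
    using arg_cong[OF D_push_torsion_free[OF that, of p], of "\<lambda>w. metric N (f p) w (tmap M N f p (Z p))"]
    by (simp add: s_def metric_tmap N.metric_simps M.metric_simps)
  have skew: "s X Y Z = - s X Z Y" if "vector_field M X" "vector_field M Y" "vector_field M Z" for X Y Z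
    using metric_D[OF that(1) field_along_tmap[OF that(2)] field_along_tmap[OF that(3)], of p]
      M.metric_conn[OF that, of p] N.metric_sym[of "f p" "D X (push Z) p"] M.metric_sym[of p "conn M X Z p"]
    by (simp add: s_def metric_tmap)
  have "s X Y Z = - s X Y Z"
    using assms sym skew by (metis minus_minus)
  then show ?thesis by (simp add: s_def)
qed

end


section \<open>Orthonormal frames\<close>

context manifold
begin

lemma smooth_fun_near_tendsto:
  assumes "smooth_fun_near h p"
  shows "(h \<longlongrightarrow> h p) (nhds p)"
  unfolding tendsto_def
proof (intro allI impI)
  fix S assume S: "open S" "h p \<in> S"
  have "((\<lambda>x. h (cinv M p x)) \<longlongrightarrow> h p) (nhds (coord M p p))"
    using smooth_near_isCont[OF assms[unfolded smooth_fun_near_def]]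
    using tendsto_at_iff_tendsto_nhds[of "\<lambda>x. h (cinv M p x)" "coord M p p"] by (simp add: isCont_def)
  then have "\<forall>\<^sub>F x in nhds (coord M p p). h (cinv M p x) \<in> S"
    using S by (rule topological_tendstoD)
  then have "\<forall>\<^sub>F q in nhds p. h (cinv M p (coord M p q)) \<in> S"
    by (rule eventually_from_chart[OF mem_cdom])
  with eventually_in_cdom[OF mem_cdom] show "\<forall>\<^sub>F q in nhds p. h q \<in> S"
    by eventually_elim simp
qed

end

context riemannian
begin

definition orthonormal_at :: "'m \<Rightarrow> (nat \<Rightarrow> 'a) \<Rightarrow> nat \<Rightarrow> bool" where
  "orthonormal_at p u k \<longleftrightarrow> (\<forall>i<k. \<forall>j<k. metric M p (u i) (u j) = (if i = j then 1 else 0))"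

lemma orthonormal_coefficient:
  assumes "orthonormal_at p u k" "j < k"
  shows "metric M p (\<Sum>i<k. c i *\<^sub>R u i) (u j) = c j"
proof -
  have "metric M p (\<Sum>i<k. c i *\<^sub>R u i) (u j) = (\<Sum>i<k. if i = j then c i else 0)"
    unfolding metric_sum_left
    by (rule sum.cong) (use assms in \<open>auto simp: metric_simps orthonormal_at_def\<close>)
  then show ?thesis using assms(2) by simp
qed

text \<open>The map with values \<open>u i\<close> on a basis is injective by orthonormality, hence surjective: there are as many
  \<open>u i\<close> as dimensions.\<close>

lemma orthonormal_expansion:
  assumes "orthonormal_at p u DIM('a)"
  shows "v = (\<Sum>i<DIM('a). metric M p v (u i) *\<^sub>R u i)"
proof -
  obtain b where b: "bij_betw b {..<DIM('a)} (Basis :: 'a set)"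
    using ex_bij_betw_nat_finite[OF finite_Basis] by (auto simp: atLeast0LessThan)
  define L where "L x = (\<Sum>i<DIM('a). (x \<bullet> b i) *\<^sub>R u i)" for x
  have "linear L"
    by (rule linearI) (simp_all add: L_def inner_add_left scaleR_add_left sum.distrib scaleR_sum_right)
  moreover have "x = 0" if "L x = 0" for x
  proof (rule euclidean_all_zero_iff[THEN iffD1], rule ballI)
    fix c :: 'a assume "c \<in> Basis"
    then obtain j where "j < DIM('a)" "b j = c" using b unfolding bij_betw_def by (metis imageE lessThan_iff)
    then show "x \<bullet> c = 0"
      using orthonormal_coefficient[OF assms, of j "\<lambda>i. x \<bullet> b i"] that
      by (simp add: L_def metric_simps)
  qed
  ultimately have "surj L"
    by (intro linear_injective_imp_surjective) (auto simp: linear_injective_0)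
  then obtain x where x: "v = L x" by (metis surjD)
  have "metric M p v (u i) = x \<bullet> b i" if "i < DIM('a)" for i
    using orthonormal_coefficient[OF assms that] by (simp add: x L_def)
  then show ?thesis by (simp add: x L_def)
qed

text \<open>The normalizing factor \<open>1 / sqrt (g (Y, Y))\<close> is smooth only where the projection \<open>Y\<close> does not
  vanish, in particular near \<open>p\<close>; away from there it is replaced by any smooth extension.\<close>

lemma gram_schmidt:
  assumes "k \<le> DIM('a)"
  shows "\<exists>e. (\<forall>i<k. vector_field M (e i)) \<and> (\<forall>\<^sub>F q in nhds p. orthonormal_at q (\<lambda>i. e i q) k)"
  using assms
proof (induction k)
  case 0
  show ?case by (simp add: orthonormal_at_def)
next
  case (Suc k)
  then obtain e where e: "\<And>i. i < k \<Longrightarrow> vector_field M (e i)"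
    "\<forall>\<^sub>F q in nhds p. orthonormal_at q (\<lambda>i. e i q) k"
    by auto
  have "dim ((\<lambda>i. e i p) ` {..<k}) < DIM('a)"
    using dim_le_card'[of "(\<lambda>i. e i p) ` {..<k}"] card_image_le[of "{..<k}" "\<lambda>i. e i p"] Suc.prems by simp
  then have "span ((\<lambda>i. e i p) ` {..<k}) \<noteq> UNIV"
    by (metis dim_eq_full less_irrefl)
  then obtain u where u: "u \<notin> span ((\<lambda>i. e i p) ` {..<k})" by auto
  obtain X where X: "vector_field M X" "X p = u" by (rule extend_vector)
  define Y where "Y q = X q - (\<Sum>i<k. metric M q (X q) (e i q) *\<^sub>R e i q)" for q
  have Y: "vector_field M Y"
    unfolding Y_def[abs_def]
    by (intro vector_field_diff vector_field_sum vector_field_scaleR smooth_metric X e) auto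
  have "Y p \<noteq> 0"
  proof
    assume "Y p = 0"
    then have "u = (\<Sum>i<k. metric M p (X p) (e i p) *\<^sub>R e i p)" by (simp add: Y_def X(2))
    also have "\<dots> \<in> span ((\<lambda>i. e i p) ` {..<k})" by (intro span_sum span_scale span_base) auto
    finally show False using u by simp
  qed
  define s where "s q = metric M q (Y q) (Y q)" for q
  have s: "smooth_fun_near s p" "s p > 0"
    using smooth_fun_nearD[OF smooth_metric[OF Y Y], of p] metric_pos[OF \<open>Y p \<noteq> 0\<close>] by (simp_all add: s_def[abs_def])
  have "smooth_near (\<lambda>t. 1 * t powr (- 1 / 2)) (s p)"
    by (rule smooth_nearI[OF smooth_on_powr]) (use s(2) in auto)
  then have "smooth_fun_near (\<lambda>q. s q powr (- 1 / 2)) p"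
    using smooth_fun_near_compose[OF s(1)] by simp
  then obtain h where h: "smooth_fun M h" "\<forall>\<^sub>F q in nhds p. h q = s q powr (- 1 / 2)"
    by (rule extend_smooth_fun)
  define e' where "e' i = (if i < k then e i else (\<lambda>q. h q *\<^sub>R Y q))" for i
  have "\<forall>i<Suc k. vector_field M (e' i)"
    using e(1) vector_field_scaleR[OF h(1) Y] by (auto simp: e'_def)
  moreover have "\<forall>\<^sub>F q in nhds p. orthonormal_at q (\<lambda>i. e' i q) (Suc k)"
    using e(2) h(2) order_tendstoD(1)[OF smooth_fun_near_tendsto[OF s(1)] s(2)]
  proof eventually_elim
    case (elim q)
    have orth: "metric M q (Y q) (e j q) = 0" if "j < k" for j
      using orthonormal_coefficient[OF elim(1) that, of "\<lambda>i. metric M q (X q) (e i q)"]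
      by (simp add: Y_def metric_simps)
    have "h q * h q = s q powr (- 1 / 2 + - 1 / 2)"
      unfolding powr_add elim(2) by (rule refl)
    then have "h q * h q = inverse (s q)"
      using elim(3) by (simp add: powr_minus)
    then have norm: "h q * (h q * metric M q (Y q) (Y q)) = 1"
      using elim(3) by (simp add: s_def mult.assoc[symmetric])
    have orth': "metric M q (e j q) (Y q) = 0" if "j < k" for j
      using orth[OF that] by (simp add: metric_sym)
    show ?case
      unfolding orthonormal_at_def
    proof (intro allI impI)
      fix i j assume "i < Suc k" "j < Suc k"
      then consider "i < k" "j < k" | "i < k" "j = k" | "i = k" "j < k" | "i = k" "j = k"
        by linarith
      then show "metric M q (e' i q) (e' j q) = (if i = j then 1 else 0)"
        by cases (use elim(1) in \<open>simp_all add: e'_def metric_simps orth orth' norm orthonormal_at_def\<close>)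
    qed
  qed
  ultimately show ?case by blast
qed

lemma orthonormal_frame_near_iff:
  "orthonormal_frame_near M p e \<longleftrightarrow>
    (\<forall>i<DIM('a). vector_field M (e i)) \<and> (\<forall>\<^sub>F q in nhds p. orthonormal_at q (\<lambda>i. e i q) DIM('a))"
  by (auto simp: orthonormal_frame_near_def eventually_nhds orthonormal_at_def)

lemma orthonormal_frame_exists: obtains e where "orthonormal_frame_near M p e"
  using gram_schmidt[of "DIM('a)" p] by (auto simp: orthonormal_frame_near_iff)

lemma orthonormal_frame_at: "orthonormal_frame_near M p e \<Longrightarrow> orthonormal_at p (\<lambda>i. e i p) DIM('a)"
  by (auto simp: orthonormal_frame_near_iff dest: eventually_nhds_x_imp_x)

end


section \<open>Tangential and normal parts, and the second fundamental form\<close>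

context riemannian_submanifold
begin

lemma tangent_part_eqI:
  assumes "\<And>v. metric N (f p) (w - tmap M N f p u) (tmap M N f p v) = 0"
  shows "tangent_part M N f p w = u"
  unfolding tangent_part_def
proof (rule the_equality)
  fix u' assume u': "\<forall>v. metric N (f p) (w - tmap M N f p u') (tmap M N f p v) = 0"
  have "metric M p u' v = metric M p u v" for v
    using assms[of v] u'[rule_format, of v] by (simp add: N.metric_simps metric_tmap)
  then have "metric M p (u' - u) (u' - u) = 0" by (simp add: M.metric_simps)
  then show "u' = u" by (simp add: M.metric_zero_iff)
qed (use assms in auto)

text \<open>Besides the existence of tangential parts, this formula yields that they depend smoothly on the point.\<close>

lemma tangent_part_frame:
  assumes "M.orthonormal_at p u DIM('a)"
  shows "tangent_part M N f p w = (\<Sum>i<DIM('a). metric N (f p) w (tmap M N f p (u i)) *\<^sub>R u i)"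
    (is "_ = ?t")
proof (rule tangent_part_eqI)
  fix v
  have "metric N (f p) w (tmap M N f p v) =
      metric N (f p) w (tmap M N f p (\<Sum>i<DIM('a). metric M p v (u i) *\<^sub>R u i))"
    using M.orthonormal_expansion[OF assms, of v] by simp
  also have "\<dots> = (\<Sum>i<DIM('a). metric M p v (u i) * metric N (f p) w (tmap M N f p (u i)))"
    by (simp add: linear_sum[OF linear_tmap] linear_cmul[OF linear_tmap] N.metric_sum_right N.metric_simps)
  also have "\<dots> = metric M p ?t v"
    by (simp add: M.metric_sum_left M.metric_simps M.metric_sym[of p v] mult.commute)
  finally show "metric N (f p) (w - tmap M N f p ?t) (tmap M N f p v) = 0"
    by (simp add: N.metric_simps metric_tmap)
qed

lemma metric_tangent_part: "metric M p (tangent_part M N f p w) v = metric N (f p) w (tmap M N f p v)"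
proof -
  obtain e where e: "orthonormal_frame_near M p e" by (rule M.orthonormal_frame_exists)
  let ?e = "\<lambda>i. e i p"
  have "metric N (f p) w (tmap M N f p v) =
      metric N (f p) w (tmap M N f p (\<Sum>i<DIM('a). metric M p v (?e i) *\<^sub>R ?e i))"
    using M.orthonormal_expansion[OF M.orthonormal_frame_at[OF e], of v] by simp
  also have "\<dots> = metric M p (tangent_part M N f p w) v"
    unfolding tangent_part_frame[OF M.orthonormal_frame_at[OF e]]
    by (simp add: linear_sum[OF linear_tmap] linear_cmul[OF linear_tmap] N.metric_sum_right N.metric_simps
        M.metric_sum_left M.metric_simps M.metric_sym[of p v] mult.commute)
  finally show ?thesis by simp
qed

lemma metric_normal_part: "metric N (f p) (normal_part M N f p w) (tmap M N f p v) = 0"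
  by (simp add: normal_part_def N.metric_simps metric_tmap metric_tangent_part)

lemma tangent_part_tmap: "tangent_part M N f p (tmap M N f p u) = u"
  by (rule tangent_part_eqI) (simp add: N.metric_simps)

lemma tangent_part_add:
  "tangent_part M N f p (w + w') = tangent_part M N f p w + tangent_part M N f p w'"
  by (rule tangent_part_eqI)
     (simp add: linear_add[OF linear_tmap] N.metric_simps metric_tmap metric_tangent_part)

lemma tangent_part_diff:
  "tangent_part M N f p (w - w') = tangent_part M N f p w - tangent_part M N f p w'"
  by (rule tangent_part_eqI)
     (simp add: linear_diff[OF linear_tmap] N.metric_simps metric_tmap metric_tangent_part)

lemma normal_part_add: "normal_part M N f p (w + w') = normal_part M N f p w + normal_part M N f p w'"
  by (simp add: normal_part_def tangent_part_add linear_add[OF linear_tmap])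

lemma normal_part_diff: "normal_part M N f p (w - w') = normal_part M N f p w - normal_part M N f p w'"
  by (simp add: normal_part_def tangent_part_diff linear_diff[OF linear_tmap])

lemma vector_field_tangent_part:
  assumes "field_along M N f V"
  shows "vector_field M (\<lambda>q. tangent_part M N f q (V q))"
  unfolding M.vector_field_iff
proof
  fix p
  obtain e where e: "orthonormal_frame_near M p e" by (rule M.orthonormal_frame_exists)
  have 1: "vector_field M (\<lambda>q. \<Sum>i<DIM('a). metric N (f q) (V q) (tmap M N f q (e i q)) *\<^sub>R e i q)"
    using e assms
    by (intro M.vector_field_sum M.vector_field_scaleR smooth_metric_along field_along_tmap)
       (auto simp: orthonormal_frame_near_def)
  have 2: "\<forall>\<^sub>F q in nhds p. (\<Sum>i<DIM('a). metric N (f q) (V q) (tmap M N f q (e i q)) *\<^sub>R e i q) =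
      tangent_part M N f q (V q)"
    using e by (auto simp: M.orthonormal_frame_near_iff tangent_part_frame elim!: eventually_mono)
  show "M.ident.field_near (\<lambda>q. tangent_part M N f q (V q)) p"
    by (rule M.ident.field_near_cong[OF 2]) (use 1 in \<open>simp add: M.vector_field_iff\<close>)
qed

lemma field_along_normal_part:
  "field_along M N f V \<Longrightarrow> field_along M N f (\<lambda>q. normal_part M N f q (V q))"
  unfolding normal_part_def by (intro field_along_diff field_along_tmap vector_field_tangent_part)

lemma second_form_eq:
  assumes "vector_field M X" "vector_field M Y"
  shows "second_form M N f D X Y p = D X (push Y) p - tmap M N f p (conn M X Y p)"
proof -
  have "tangent_part M N f p (D X (push Y) p) = conn M X Y p"
  proof (rule tangent_part_eqI)
    fix v
    obtain Z where "vector_field M Z" "Z p = v" by (rule M.extend_vector)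
    then show "metric N (f p) (D X (push Y) p - tmap M N f p (conn M X Y p)) (tmap M N f p v) = 0"
      using gauss_formula[OF assms, of Z p] by (simp add: N.metric_simps metric_tmap)
  qed
  then show ?thesis by (simp add: second_form_def normal_part_def)
qed

lemma second_form_sym:
  "vector_field M X \<Longrightarrow> vector_field M Y \<Longrightarrow> second_form M N f D X Y p = second_form M N f D Y X p"
  using D_push_torsion_free[of X Y p] by (simp add: second_form_eq linear_diff[OF linear_tmap] algebra_simps)

lemma field_along_second_form:
  assumes "vector_field M X" "vector_field M Y"
  shows "field_along M N f (second_form M N f D X Y)"
  unfolding second_form_def[abs_def]
  by (intro field_along_normal_part D_field field_along_tmap assms)

lemma second_form_normal: "metric N (f p) (second_form M N f D X Y p) (tmap M N f p v) = 0"
  by (simp add: second_form_def metric_normal_part)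

text \<open>Neither \<open>D\<close> nor \<open>\<nabla>\<close> differentiates the coefficients of the field in the first slot, so the second
  fundamental form is tensorial there, and by symmetry also in the second.\<close>

lemma second_form_frame:
  assumes "orthonormal_frame_near M p e" "vector_field M X" "vector_field M Y"
  shows "second_form M N f D X Y p = (\<Sum>i<DIM('a). metric M p (X p) (e i p) *\<^sub>R second_form M N f D (e i) Y p)"
proof -
  have e: "vector_field M (e i)" if "i < DIM('a)" for i
    using assms(1) that by (simp add: orthonormal_frame_near_def)
  let ?X = "\<lambda>q. \<Sum>i<DIM('a). metric M q (X q) (e i q) *\<^sub>R e i q"
  have X: "vector_field M ?X"
    using e assms(2) by (intro M.vector_field_sum M.vector_field_scaleR M.smooth_metric) auto
  have "\<forall>\<^sub>F q in nhds p. X q = ?X q"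
    using assms(1) M.orthonormal_expansion
    by (auto simp: M.orthonormal_frame_near_iff elim!: eventually_mono)
  then have "D X (push Y) p = D ?X (push Y) p" "conn M X Y p = conn M ?X Y p"
    using D_cong_left[OF assms(2) X field_along_tmap[OF assms(3)]]
      M.conn.D_cong_left[OF assms(2) X assms(3)[unfolded vector_field_def]] by auto
  moreover have "D ?X (push Y) p = (\<Sum>i<DIM('a). metric M p (X p) (e i p) *\<^sub>R D (e i) (push Y) p)"
    using e assms(2,3) by (intro D_sum_left) (auto intro: M.smooth_metric field_along_tmap)
  moreover have "conn M ?X Y p = (\<Sum>i<DIM('a). metric M p (X p) (e i p) *\<^sub>R conn M (e i) Y p)"
    using e assms(2,3) by (intro M.conn.D_sum_left) (auto intro: M.smooth_metric simp: vector_field_def[symmetric])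
  ultimately show ?thesis
    using e assms(2,3)
    by (simp add: second_form_eq linear_sum[OF linear_tmap] linear_cmul[OF linear_tmap]
        scaleR_diff_right sum_subtractf)
qed

text \<open>Two orthonormal frames differ at \<open>p\<close> by an orthogonal matrix \<open>a\<close>, and \<open>a\<^sup>T a = 1\<close> is the Parseval identity
  for the frame \<open>e'\<close>.  So the description of the mean curvature vector determines it uniquely.\<close>

lemma trace_second_form_frame_independent:
  assumes e: "orthonormal_frame_near M p e" and e': "orthonormal_frame_near M p e'"
  shows "(\<Sum>i<DIM('a). second_form M N f D (e' i) (e' i) p) = (\<Sum>i<DIM('a). second_form M N f D (e i) (e i) p)"
proof -
  let ?h = "\<lambda>X Y. second_form M N f D X Y p" and ?n = "DIM('a)"
  define a where "a i j = metric M p (e' i p) (e j p)" for i j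
  have fields: "vector_field M (e i)" "vector_field M (e' i)" if "i < ?n" for i
    using e e' that by (simp_all add: orthonormal_frame_near_def)
  have "?h (e' i) (e' i) = (\<Sum>j<?n. \<Sum>k<?n. (a i j * a i k) *\<^sub>R ?h (e k) (e j))" if i: "i < ?n" for i
  proof -
    have "?h (e' i) (e' i) = (\<Sum>j<?n. a i j *\<^sub>R ?h (e' i) (e j))"
      using second_form_frame[OF e fields(2)[OF i] fields(2)[OF i]] fields i
      by (simp add: a_def second_form_sym[of "e _" "e' i"])
    also have "\<dots> = (\<Sum>j<?n. a i j *\<^sub>R (\<Sum>k<?n. a i k *\<^sub>R ?h (e k) (e j)))"
      using second_form_frame[OF e fields(2)[OF i] fields(1)] by (simp add: a_def)
    finally show ?thesis by (simp add: scaleR_sum_right)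
  qed
  then have "(\<Sum>i<?n. ?h (e' i) (e' i)) = (\<Sum>i<?n. \<Sum>j<?n. \<Sum>k<?n. (a i j * a i k) *\<^sub>R ?h (e k) (e j))"
    by simp
  also have "\<dots> = (\<Sum>j<?n. \<Sum>i<?n. \<Sum>k<?n. (a i j * a i k) *\<^sub>R ?h (e k) (e j))"
    by (rule sum.swap)
  also have "\<dots> = (\<Sum>j<?n. \<Sum>k<?n. \<Sum>i<?n. (a i j * a i k) *\<^sub>R ?h (e k) (e j))"
    by (intro sum.cong refl sum.swap)
  also have "\<dots> = (\<Sum>j<?n. \<Sum>k<?n. (if k = j then 1 else 0) *\<^sub>R ?h (e k) (e j))"
  proof (intro sum.cong refl)
    fix j k assume jk: "j \<in> {..<?n}" "k \<in> {..<?n}"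
    have "(\<Sum>i<?n. a i j * a i k) = metric M p (\<Sum>i<?n. metric M p (e j p) (e' i p) *\<^sub>R e' i p) (e k p)"
      by (simp add: M.metric_sum_left M.metric_simps a_def M.metric_sym[of p "e j p"])
    also have "\<dots> = metric M p (e j p) (e k p)"
      using M.orthonormal_expansion[OF M.orthonormal_frame_at[OF e'], of "e j p"] by simp
    also have "\<dots> = (if k = j then 1 else 0)"
      using M.orthonormal_frame_at[OF e] jk by (auto simp: M.orthonormal_at_def)
    finally show "(\<Sum>i<?n. (a i j * a i k) *\<^sub>R ?h (e k) (e j)) = (if k = j then 1 else 0) *\<^sub>R ?h (e k) (e j)"
      by (simp add: scaleR_sum_left[symmetric] del: scaleR_sum_left)
  qed
  also have "\<dots> = (\<Sum>j<?n. ?h (e j) (e j))"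
    by (intro sum.cong refl) (simp add: if_distrib[of "\<lambda>c. c *\<^sub>R _"] cong: if_cong)
  finally show ?thesis .
qed

lemma mean_curvature_frame:
  assumes "orthonormal_frame_near M p e"
  shows "mean_curvature M N f D p = (1 / real DIM('a)) *\<^sub>R (\<Sum>i<DIM('a). second_form M N f D (e i) (e i) p)"
  unfolding mean_curvature_def
proof (rule the_equality)
  fix w
  assume "\<exists>e. orthonormal_frame_near M p e \<and>
    w = (1 / real DIM('a)) *\<^sub>R (\<Sum>i<DIM('a). second_form M N f D (e i) (e i) p)"
  then obtain e' where e': "orthonormal_frame_near M p e'"
    "w = (1 / real DIM('a)) *\<^sub>R (\<Sum>i<DIM('a). second_form M N f D (e' i) (e' i) p)"
    by blast
  show "w = (1 / real DIM('a)) *\<^sub>R (\<Sum>i<DIM('a). second_form M N f D (e i) (e i) p)"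
    unfolding e'(2) trace_second_form_frame_independent[OF assms e'(1)] ..
qed (use assms in blast)

lemma field_along_mean_curvature: "field_along M N f (mean_curvature M N f D)"
  unfolding field_along_iff
proof
  fix p
  obtain e where e: "orthonormal_frame_near M p e" by (rule M.orthonormal_frame_exists)
  then have 1: "field_along M N f (\<lambda>q. (1 / real DIM('a)) *\<^sub>R (\<Sum>i<DIM('a). second_form M N f D (e i) (e i) q))"
    by (intro field_along_cmult field_along_sum field_along_second_form) (auto simp: orthonormal_frame_near_def)
  have "\<forall>\<^sub>F q in nhds p. orthonormal_frame_near M q e"
    using e by (auto simp: M.orthonormal_frame_near_iff eventually_eventually)
  then have 2: "\<forall>\<^sub>F q in nhds p. (1 / real DIM('a)) *\<^sub>R (\<Sum>i<DIM('a). second_form M N f D (e i) (e i) q) =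
      mean_curvature M N f D q"
    by (auto simp: mean_curvature_frame elim!: eventually_mono)
  show "field_near (mean_curvature M N f D) p"
    by (rule field_near_cong[OF 2]) (use 1 in \<open>simp add: field_along_iff\<close>)
qed

lemma mean_curvature_normal: "metric N (f p) (mean_curvature M N f D p) (tmap M N f p v) = 0"
proof -
  obtain e where e: "orthonormal_frame_near M p e" by (rule M.orthonormal_frame_exists)
  show ?thesis
    by (simp add: mean_curvature_frame[OF e] N.metric_simps N.metric_sum_left second_form_normal)
qed

text \<open>Differentiate \<open>g (\<xi>, Y) = 0\<close>.  This needs \<open>\<xi>\<close> to be a smooth normal field; for \<open>\<xi> = C H\<close> that rests on
  the smoothness of \<open>H\<close>.\<close>

lemma metric_shape_operator:
  assumes X: "vector_field M X" and Y: "vector_field M Y" and \<xi>: "field_along M N f \<xi>"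
    and normal: "\<And>q v. metric N (f q) (\<xi> q) (tmap M N f q v) = 0"
  shows "metric M p (Y p) (shape_operator M N f D \<xi> X p) = metric N (f p) (second_form M N f D X Y p) (\<xi> p)"
proof -
  have "metric M p (Y p) (shape_operator M N f D \<xi> X p) = - metric N (f p) (D X \<xi> p) (push Y p)"
    by (simp add: shape_operator_def M.metric_simps M.metric_sym[of p "Y p"] metric_tangent_part)
  also have "\<dots> = metric N (f p) (\<xi> p) (D X (push Y) p)"
    using metric_D[OF X \<xi> field_along_tmap[OF Y], of p] by (simp add: normal)
  also have "\<dots> = metric N (f p) (second_form M N f D X Y p) (\<xi> p)"
    by (simp add: second_form_eq[OF X Y] N.metric_sym[of _ _ "\<xi> p"] N.metric_simps normal)
  finally show ?thesis .
qed

end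


section \<open>Submanifolds of locally product manifolds\<close>

locale product_submanifold = riemannian_submanifold M N f D
  for M :: "('m::{t2_space,second_countable_topology}, 'a::euclidean_space) riemannian"
    and N :: "('n::{t2_space,second_countable_topology}, 'b::euclidean_space) product_riemannian"
    and f D +
  assumes locally_product: "locally_product_manifold N"
begin

lemma linear_prodstr: "linear (prodstr N y)"
  and vector_field_prodstr: "vector_field N W \<Longrightarrow> vector_field N (\<lambda>y. prodstr N y (W y))"
  and prodstr_prodstr: "prodstr N y (prodstr N y w) = w"
  and metric_prodstr: "metric N y (prodstr N y w) (prodstr N y w') = metric N y w w'"
  and conn_prodstr: "vector_field N Z \<Longrightarrow> vector_field N W \<Longrightarrow>
    conn N Z (\<lambda>y. prodstr N y (W y)) y = prodstr N y (conn N Z W y)"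
  using locally_product unfolding locally_product_manifold_def by force+

lemma prodstr_self_adjoint: "metric N y (prodstr N y w) w' = metric N y w (prodstr N y w')"
  using metric_prodstr[of y w "prodstr N y w'"] by (simp add: prodstr_prodstr)

lemma field_along_prodstr:
  assumes "field_along M N f V"
  shows "field_along M N f (\<lambda>q. prodstr N (f q) (V q))"
  unfolding field_along_iff
proof
  fix p
  show "field_near (\<lambda>q. prodstr N (f q) (V q)) p"
    using assms
  proof (induction rule: field_along_induct[where p = p])
    case (compose W)
    then show ?case
      using field_along_compose[OF vector_field_prodstr] by (simp add: field_along_iff)
  next
    case (add V W)
    then show ?case by (simp add: linear_add[OF linear_prodstr] field_near_add)
  next
    case (scale h V)
    then show ?case by (simp add: linear_cmul[OF linear_prodstr] field_near_scaleR M.smooth_fun_nearD)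
  next
    case (cong V W)
    then show ?case by (elim field_near_cong[rotated]) (auto elim!: eventually_mono)
  qed
qed

lemma D_prodstr:
  assumes X: "vector_field M X" and "field_along M N f V"
  shows "D X (\<lambda>q. prodstr N (f q) (V q)) p = prodstr N (f p) (D X V p)"
  using assms(2)
proof (induction rule: field_along_induct[where p = p])
  case (compose W)
  obtain Z where Z: "vector_field N Z" "Z (f p) = tmap M N f p (X p)"
    by (rule N.extend_vector)
  then show ?case
    using D_compose[OF X Z(1) vector_field_prodstr[OF compose] Z(2)] D_compose[OF X Z(1) compose Z(2)]
    by (simp add: conn_prodstr compose)
next
  case (add V W)
  then show ?case
    by (simp add: linear_add[OF linear_prodstr] D_add[OF X] field_along_prodstr)
next
  case (scale h V)
  then show ?case
    by (simp add: linear_add[OF linear_prodstr] linear_cmul[OF linear_prodstr] D_scale[OF _ X] field_along_prodstr)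
next
  case (cong V W)
  have "\<forall>\<^sub>F q in nhds p. prodstr N (f q) (V q) = prodstr N (f q) (W q)"
    using cong.hyps(3) by (auto elim: eventually_mono)
  then show ?case
    using D_cong[OF X field_along_prodstr[OF cong.hyps(1)] field_along_prodstr[OF cong.hyps(2)]]
      D_cong[OF X cong.hyps] cong.IH by simp
qed

text \<open>Apply \<open>D\<^sub>X\<close> to \<open>F Y = \<phi> Y + \<omega> Y\<close> and compare normal parts.  On the left \<open>D\<^sub>X (F Y) = F (\<nabla>\<^sub>X Y + h (X, Y))\<close>
  because \<open>F\<close> is parallel; its normal part is \<open>\<omega> \<nabla>\<^sub>X Y + C h (X, Y)\<close>.\<close>

lemma nabla_omega_eq:
  assumes X: "vector_field M X" and Y: "vector_field M Y"
  shows "nabla_omega M N f D X Y p =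
    C_op M N f p (second_form M N f D X Y p) - second_form M N f D X (\<lambda>q. phi_op M N f q (Y q)) p"
proof -
  let ?\<phi>Y = "\<lambda>q. phi_op M N f q (Y q)"
  have FY: "field_along M N f (\<lambda>q. prodstr N (f q) (push Y q))"
    by (intro field_along_prodstr field_along_tmap Y)
  have \<phi>Y: "vector_field M ?\<phi>Y"
    unfolding phi_op_def by (rule vector_field_tangent_part[OF FY])
  have \<omega>Y: "(\<lambda>q. omega_op M N f q (Y q)) = (\<lambda>q. prodstr N (f q) (push Y q) - push ?\<phi>Y q)"
    by (simp add: omega_op_def normal_part_def phi_op_def)
  have "D X (\<lambda>q. prodstr N (f q) (push Y q)) p = D X (\<lambda>q. omega_op M N f q (Y q)) p + D X (push ?\<phi>Y) p"
    unfolding \<omega>Y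
    using D_add[OF X field_along_diff[OF FY field_along_tmap[OF \<phi>Y]] field_along_tmap[OF \<phi>Y], of p] by simp
  then have "D X (\<lambda>q. omega_op M N f q (Y q)) p = prodstr N (f p) (D X (push Y) p) - D X (push ?\<phi>Y) p"
    using D_prodstr[OF X field_along_tmap[OF Y], of p] by simp
  then have "normal_connection M N f D X (\<lambda>q. omega_op M N f q (Y q)) p =
      normal_part M N f p (prodstr N (f p) (D X (push Y) p)) - second_form M N f D X ?\<phi>Y p"
    by (simp add: normal_connection_def normal_part_diff second_form_def)
  moreover have "prodstr N (f p) (D X (push Y) p) =
      prodstr N (f p) (tmap M N f p (conn M X Y p)) + prodstr N (f p) (second_form M N f D X Y p)"
    by (simp add: second_form_eq[OF X Y] linear_add[OF linear_prodstr, symmetric])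
  ultimately show ?thesis
    by (simp add: nabla_omega_def C_op_def omega_op_def normal_part_add)
qed

lemma metric_C_op:
  assumes "\<And>v. metric N (f p) \<xi> (tmap M N f p v) = 0"
  shows "metric N (f p) (C_op M N f p \<xi>') \<xi> = metric N (f p) (prodstr N (f p) \<xi>') \<xi>"
  by (simp add: C_op_def normal_part_def N.metric_simps N.metric_sym[of _ "tmap M N f p _"] assms)

text \<open>As \<open>F\<close> is self-adjoint, so is \<open>C\<close>: the term \<open>g (C h (X, Y), \<xi>)\<close> of \<open>nabla_omega_eq\<close> is the shape operator
  in the direction \<open>C \<xi>\<close>.\<close>

lemma nabla_omega_minus_shape_operator:
  assumes X: "vector_field M X" and Y: "vector_field M Y"
    and \<xi>: "field_along M N f \<xi>" and normal: "\<And>q v. metric N (f q) (\<xi> q) (tmap M N f q v) = 0"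
  shows "metric N (f p) (nabla_omega M N f D X Y p) (\<xi> p) =
    metric M p (Y p) (shape_operator M N f D (\<lambda>q. C_op M N f q (\<xi> q)) X p) -
    metric N (f p) (second_form M N f D X (\<lambda>q. phi_op M N f q (Y q)) p) (\<xi> p)"
proof -
  let ?h = "second_form M N f D X Y p"
  have C: "field_along M N f (\<lambda>q. C_op M N f q (\<xi> q))"
    unfolding C_op_def by (intro field_along_normal_part field_along_prodstr \<xi>)
  have "metric N (f p) (C_op M N f p ?h) (\<xi> p) = metric N (f p) ?h (prodstr N (f p) (\<xi> p))"
    by (simp add: metric_C_op normal prodstr_self_adjoint)
  also have "\<dots> = metric N (f p) ?h (C_op M N f p (\<xi> p))"
    using metric_C_op[where \<xi>' = "\<xi> p", OF second_form_normal] by (simp add: N.metric_sym[of "f p" ?h])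
  also have "\<dots> = metric M p (Y p) (shape_operator M N f D (\<lambda>q. C_op M N f q (\<xi> q)) X p)"
    using metric_shape_operator[OF X Y C, of p] by (simp add: C_op_def metric_normal_part)
  finally show ?thesis
    by (simp add: nabla_omega_eq[OF X Y] N.metric_simps)
qed

lemma vector_field_phi:
  assumes "vector_field M Y" shows "vector_field M (\<lambda>q. phi_op M N f q (Y q))"
  unfolding phi_op_def by (intro vector_field_tangent_part field_along_prodstr field_along_tmap assms)

text \<open>For a pseudo-umbilical submanifold, the two sides of the identity differ by \<open>g (X, \<phi> Y) g (H, H)\<close>.  If some
  \<open>\<phi> Y\<close> is not zero at \<open>p\<close>, then taking \<open>X = \<phi> Y\<close> gives \<open>H p = 0\<close>.\<close>

lemma omega_identity_iff:
  assumes umbilical: "pseudo_umbilical M N f D"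
  defines "H \<equiv> mean_curvature M N f D"
  shows "(\<forall>X Y p. vector_field M X \<longrightarrow> vector_field M Y \<longrightarrow>
      metric N (f p) (nabla_omega M N f D X Y p) (H p) =
      metric M p (Y p) (shape_operator M N f D (\<lambda>q. C_op M N f q (H q)) X p)) \<longleftrightarrow>
    (\<forall>p. H p = 0 \<or> (\<forall>u. phi_op M N f p u = 0))" (is "?identity \<longleftrightarrow> ?rhs")
proof -
  have H: "field_along M N f H" "\<And>q v. metric N (f q) (H q) (tmap M N f q v) = 0"
    unfolding H_def by (rule field_along_mean_curvature mean_curvature_normal)+
  have "metric N (f p) (nabla_omega M N f D X Y p) (H p) =
      metric M p (Y p) (shape_operator M N f D (\<lambda>q. C_op M N f q (H q)) X p) -
      metric M p (X p) (phi_op M N f p (Y p)) * metric N (f p) (H p) (H p)"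
    if "vector_field M X" "vector_field M Y" for X Y p
    using nabla_omega_minus_shape_operator[OF that H, of p] umbilical that vector_field_phi[OF that(2)]
    unfolding pseudo_umbilical_def H_def by simp
  then have "?identity \<longleftrightarrow> (\<forall>X Y p. vector_field M X \<longrightarrow> vector_field M Y \<longrightarrow>
      metric M p (X p) (phi_op M N f p (Y p)) = 0 \<or> H p = 0)"
    by (simp add: N.metric_zero_iff)
  also have "\<dots> \<longleftrightarrow> ?rhs"
  proof
    assume *: "\<forall>X Y p. vector_field M X \<longrightarrow> vector_field M Y \<longrightarrow>
      metric M p (X p) (phi_op M N f p (Y p)) = 0 \<or> H p = 0"
    show ?rhs
    proof (intro allI disjCI)
      fix p u assume "\<not> (\<forall>u. phi_op M N f p u = 0)"
      then obtain u where u: "phi_op M N f p u \<noteq> 0" by auto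
      obtain Y where Y: "vector_field M Y" "Y p = u" by (rule M.extend_vector)
      show "H p = 0"
        using *[rule_format, OF vector_field_phi[OF Y(1)] Y(1), of p] u by (simp add: Y(2) M.metric_zero_iff)
    qed
  qed (auto simp: M.metric_simps)
  finally show ?thesis .
qed

text \<open>On the invariant distribution \<open>E\<close> the map \<open>\<phi>\<close> is the restriction of \<open>F\<close> and thus injective; on
  \<open>E'\<close> it vanishes.  So \<open>\<phi>\<close> vanishes at one point only if it vanishes at all of them.\<close>

lemma phi_zero_iff_rank_zero:
  assumes "semi_invariant_splitting M N f k l E E'"
  shows "(\<forall>u. phi_op M N f p u = 0) \<longleftrightarrow> k = 0"
proof -
  have E: "subspace (E p)" "dim (E p) = k" "\<And>v. \<exists>u\<in>E p. \<exists>w\<in>E' p. v = u + w"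
    "prodstr N (f p) ` (tmap M N f p ` E p) = tmap M N f p ` E p"
    "\<And>w v. w \<in> E' p \<Longrightarrow> metric N (f p) (prodstr N (f p) (tmap M N f p w)) (tmap M N f p v) = 0"
    using assms unfolding semi_invariant_splitting_def distribution_def by blast+
  show ?thesis
  proof
    assume \<phi>: "\<forall>u. phi_op M N f p u = 0"
    have "u = 0" if "u \<in> E p" for u
    proof -
      have "prodstr N (f p) (tmap M N f p u) \<in> prodstr N (f p) ` (tmap M N f p ` E p)"
        using that by (intro imageI)
      then obtain u' where u': "prodstr N (f p) (tmap M N f p u) = tmap M N f p u'"
        unfolding E(4) by (rule imageE)
      have "u' = phi_op M N f p u"
        by (simp only: phi_op_def u' tangent_part_tmap)
      then have "u' = 0" using \<phi> by simp
      then have "tmap M N f p u = 0"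
        using u' prodstr_prodstr[of "f p" "tmap M N f p u"]
        by (simp add: linear_0[OF linear_tmap] linear_0[OF linear_prodstr])
      then show ?thesis
        using tangent_part_tmap[of p u] tangent_part_tmap[of p 0] by (simp add: linear_0[OF linear_tmap])
    qed
    then have "E p \<subseteq> {0}" by auto
    then show "k = 0" using E(2) dim_eq_0[of "E p"] by simp
  next
    assume "k = 0"
    then have "E p \<subseteq> {0}" using E(2) dim_eq_0[of "E p"] by simp
    then have "u \<in> E' p" for u using E(3)[of u] by auto
    then show "\<forall>u. phi_op M N f p u = 0"
      unfolding phi_op_def using E(5)
      by (intro allI tangent_part_eqI) (simp add: linear_0[OF linear_tmap])
  qed
qed

end

theorem theorem6:
  fixes M :: "('m::{t2_space,second_countable_topology}, 'a::euclidean_space) riemannian"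
    and N :: "('n::{t2_space,second_countable_topology}, 'b::euclidean_space) product_riemannian"
    and f :: "'m \<Rightarrow> 'n"
    and D :: "('m \<Rightarrow> 'a) \<Rightarrow> ('m \<Rightarrow> 'b) \<Rightarrow> 'm \<Rightarrow> 'b"
    and H :: "'m \<Rightarrow> 'b"
  assumes "locally_product_manifold N"
    and "riemannian_manifold M"
    and "isometric_immersion M N f"
    and "pullback_connection M N f D"
    and "pseudo_umbilical M N f D"
    and "H = mean_curvature M N f D"
  shows "let identity = (\<forall>X Y p. vector_field M X \<longrightarrow> vector_field M Y \<longrightarrow>
            metric N (f p) (nabla_omega M N f D X Y p) (H p) =
            metric M p (Y p) (shape_operator M N f D (\<lambda>q. C_op M N f q (H q)) X p))
         in (semi_invariant M N f \<longrightarrow> (identity \<longleftrightarrow> minimal M N f D \<or> anti_invariant M N f)) \<and>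
            (identity \<longleftrightarrow> (\<forall>p. H p = 0 \<or> (\<forall>u. phi_op M N f p u = 0)))"
proof -
  have N: "riemannian_manifold N" using assms(1) by (simp add: locally_product_manifold_def)
  interpret product_submanifold M N f D
    by unfold_locales (use assms N in \<open>auto simp: riemannian_manifold_def\<close>)
  have minimal: "minimal M N f D \<longleftrightarrow> (\<forall>p. H p = 0)"
    by (simp add: minimal_def assms(6))
  have anti: "\<forall>p u. phi_op M N f p u = 0" if "anti_invariant M N f"
    using that phi_zero_iff_rank_zero unfolding anti_invariant_def by blast
  have "(\<forall>p. H p = 0 \<or> (\<forall>u. phi_op M N f p u = 0)) \<longleftrightarrow> minimal M N f D \<or> anti_invariant M N f"
    if semi: "semi_invariant M N f"
  proof -
    obtain k l E E' where split: "semi_invariant_splitting M N f k l E E'"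
      using semi unfolding semi_invariant_def by blast
    show ?thesis
    proof (cases "k = 0")
      case True
      then have "anti_invariant M N f" using split unfolding anti_invariant_def by blast
      then show ?thesis using anti by blast
    next
      case False
      \<comment> \<open>The rank of \<open>E\<close> is the same at all points, so \<open>\<phi>\<close> vanishes nowhere and \<open>H\<close> vanishes everywhere.\<close>
      then have nonzero: "\<not> (\<forall>u. phi_op M N f p u = 0)" for p
        using phi_zero_iff_rank_zero[OF split] by simp
      then have "\<not> anti_invariant M N f" using anti by blast
      then show ?thesis unfolding minimal using nonzero by blast
    qed
  qed
  then show ?thesis
    using omega_identity_iff[OF assms(5)] unfolding Let_def assms(6) by blast
qed

end
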